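(* Let $\epsilon\in\{1,-1\}$ and let $f\colon S\to S^3$ be a non-conformal harmonic map with adapted complex coordinate $z$, with associated functions $\phi,\mu$; let $f^\epsilon$ be its $\epsilon$-transform, with associated functions $\phi^\epsilon,\mu^\epsilon$. The following statements are equivalent: (a) $f$ is congruent to its $\epsilon$-transform $f^\epsilon$; (b) $\phi=\phi^\epsilon$ and $\mu=\mu^\epsilon$; (c) the function $\phi$ is constant; (d) the function $\mu$ is constant and non-zero. If one of these statements holds, all maps in the sequence $\{f^p\mid p\in\mathbb{Z}\}$ associated to $f$ are the same up to congruence.
   Context: Identify $\mathbb{R}^4$ with the quaternions $\mathbb{H}$ (basis $1,e_1,e_2,e_3$ with $e_1^2=e_2^2=e_3^2=e_1e_2e_3=-1$), $\mathbb{R}^3$ with the imaginary quaternions $\operatorname{Im}\mathbb{H}$, and $S^3$ with the unit quaternions. $\langle\,,\rangle$ and $\times$ denote the Euclidean inner product and the vector product of $\mathbb{R}^3$, extended complex-bilinearly to complexified vectors. For a complex coordinate $z=x+iy$ write $\partial=\partial/\partial z$, $\bar\partial=\partial/\partial\bar z$. A smooth map $f\colon S\to S^3\subset\mathbb{R}^4$ from a (connected) Riemann surface is harmonic if $\partial\bar\partial f=-|\partial f|^2 f$, where $|\partial f|^2=\langle\partial f,\bar\partial f\rangle$. The map is called non-conformal if $\langle \partial f,\partial f\rangle\neq 0$; then there are complex coordinates $z$ with $\langle\partial f,\partial f\rangle=-1$, called adapted complex coordinates for $f$. Standing convention: an adapted coordinate $z=x+iy$ is fixed on $S$, and it is used for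 all constructions. Define $\operatorname{Im}\mathbb{H}$-valued functions $\alpha,\beta$ by $f_x=f\alpha$, $f_y=f\beta$ (quaternion product). Adaptedness gives $\langle\alpha,\beta\rangle=0$ and a non-negative function $\phi$ with $|\alpha|=2\sinh\phi$, $|\beta|=2\cosh\phi$. Standing assumption: $\alpha\neq 0$, i.e. $\phi>0$, on $S$. Put $N=\tfrac{1}{2}\operatorname{csch}(2\phi)\, f(\alpha\times\beta)$ (the unit normal) and $\mu=\langle\partial\partial f,N\rangle$. For $\epsilon=\pm1$ the $\epsilon$-transform of $f$ is $$f^{\epsilon}=\tfrac{\epsilon i}{2}\operatorname{sech}^2\phi\,(\partial f-\bar\partial f)+\tanh\phi\,N=\tfrac12\operatorname{sech}^2\phi\; f\bigl(\epsilon\beta+\tfrac12\,\alpha\times\beta\bigr)$$ (the last expression makes sense also where $\alpha=0$); write $f^+$, $f^-$ for $\epsilon=1,-1$. It is known that $f^\epsilon$ is again a non-conformal harmonic map into $S^3$ for which $z$ is adapted, that $(f^+)^-=(f^-)^+=f$, and that the function $\phi^\epsilon$ of $f^\epsilon$ is positive on an open dense subset $U^\epsilon\subset S$. The objects $\alpha^\epsilon,\beta^\epsilon,\phi^\epsilon,N^\epsilon,\mu^\epsilon$ are those defined from $f^\epsilon$ (with the same $z$) as $\alpha,\beta,\phi,N,\mu$ are from $f$; $N^\epsilon,\mu^\epsilon$ are defined on $U^\epsilon$. The sequence associated to $f$ is $f^0=f$, $f^{p+1}=(f^p)^+$, $f^{p-1}=(f^p)^-$ for $p\in\mathbb{Z}$.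 Two maps $f,g\colon S\to S^3$ are congruent if $g=R\circ f$ for some isometry $R\in O(4)$ of $S^3$. *)

theory Defs
  imports "HOL-Analysis.Analysis"
begin

(* Quaternions: real^4 with basis 1, e1, e2, e3 (components $1, $2, $3, $4); the inner product
   of the library on real^4 is the Euclidean one, and the unit quaternions are sphere 0 1. *)

definition qmult :: "real^4 \<Rightarrow> real^4 \<Rightarrow> real^4"  (infixl \<open>\<odot>\<close> 70) where
  "p \<odot> q = vector
     [p$1 * q$1 - p$2 * q$2 - p$3 * q$3 - p$4 * q$4,
      p$1 * q$2 + p$2 * q$1 + p$3 * q$4 - p$4 * q$3,
      p$1 * q$3 - p$2 * q$4 + p$3 * q$1 + p$4 * q$2,
      p$1 * q$4 + p$2 * q$3 - p$3 * q$2 + p$4 * q$1]"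

definition imq :: "real^3 \<Rightarrow> real^4" where
  "imq v = vector [0, v$1, v$2, v$3]"

lemma quaternion_basis:
  defines "e1 \<equiv> imq (axis 1 1)" and "e2 \<equiv> imq (axis 2 1)" and "e3 \<equiv> imq (axis 3 1)"
  shows "e1 \<odot> e1 = - axis 1 1" "e2 \<odot> e2 = - axis 1 1" "e3 \<odot> e3 = - axis 1 1"
    and "e1 \<odot> e2 \<odot> e3 = - axis 1 1" and "axis 1 1 \<odot> q = q" and "q \<odot> axis 1 1 = q"
  unfolding e1_def e2_def e3_def
  by (simp_all add: qmult_def imq_def vec_eq_iff forall_4 vector_def axis_def)

definition cvec :: "real^'n \<Rightarrow> complex^'n" where
  "cvec v = (\<chi> i. of_real (v$i))"

(* Complex-bilinear, not Hermitian. *)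
definition cdot :: "complex^'n \<Rightarrow> complex^'n \<Rightarrow> complex" where
  "cdot u v = (\<Sum>i\<in>UNIV. u$i * v$i)"

(* The Riemann surface S, on which a complex coordinate z = x + iy is fixed, is given by its
   image under z: an open connected nonempty subset of the complex plane.  Maps on S are total
   functions of the coordinate whose values outside S are irrelevant. *)

definition dx :: "(complex \<Rightarrow> 'b::real_normed_vector) \<Rightarrow> complex \<Rightarrow> 'b" where
  "dx F z = frechet_derivative F (at z) 1"

definition dy :: "(complex \<Rightarrow> 'b::real_normed_vector) \<Rightarrow> complex \<Rightarrow> 'b" where
  "dy F z = frechet_derivative F (at z) \<i>"

definition del :: "(complex \<Rightarrow> complex^'n) \<Rightarrow> complex \<Rightarrow> complex^'n" where
  "del F z = (1/2) *s (dx F z - \<i> *s dy F z)"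

definition delbar :: "(complex \<Rightarrow> complex^'n) \<Rightarrow> complex \<Rightarrow> complex^'n" where
  "delbar F z = (1/2) *s (dx F z + \<i> *s dy F z)"

primrec Ck_on :: "nat \<Rightarrow> (complex \<Rightarrow> 'b::real_normed_vector) \<Rightarrow> complex set \<Rightarrow> bool" where
  "Ck_on 0 F S \<longleftrightarrow> continuous_on S F"
| "Ck_on (Suc k) F S \<longleftrightarrow>
     (\<forall>z\<in>S. F differentiable (at z)) \<and> Ck_on k (dx F) S \<and> Ck_on k (dy F) S"

definition smooth_map_on :: "(complex \<Rightarrow> 'b::real_normed_vector) \<Rightarrow> complex set \<Rightarrow> bool" where
  "smooth_map_on F S \<longleftrightarrow> (\<forall>k. Ck_on k F S)"

definition harmonic_map_on :: "(complex \<Rightarrow> real^4) \<Rightarrow> complex set \<Rightarrow> bool" where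
  "harmonic_map_on f S \<longleftrightarrow>
     smooth_map_on f S \<and> f ` S \<subseteq> sphere 0 1 \<and>
     (let F = (\<lambda>z. cvec (f z)) in
        \<forall>z\<in>S. del (delbar F) z = - (cdot (del F z) (delbar F z)) *s F z)"

definition nonconformal_on :: "(complex \<Rightarrow> real^4) \<Rightarrow> complex set \<Rightarrow> bool" where
  "nonconformal_on f S \<longleftrightarrow>
     (let F = (\<lambda>z. cvec (f z)) in \<forall>z\<in>S. cdot (del F z) (del F z) \<noteq> 0)"

definition adapted_on :: "(complex \<Rightarrow> real^4) \<Rightarrow> complex set \<Rightarrow> bool" where
  "adapted_on f S \<longleftrightarrow>
     (let F = (\<lambda>z. cvec (f z)) in \<forall>z\<in>S. cdot (del F z) (del F z) = -1)"

definition alpha :: "(complex \<Rightarrow> real^4) \<Rightarrow> complex \<Rightarrow> real^3" where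
  "alpha f z = (THE a. dx f z = f z \<odot> imq a)"

definition beta :: "(complex \<Rightarrow> real^4) \<Rightarrow> complex \<Rightarrow> real^3" where
  "beta f z = (THE b. dy f z = f z \<odot> imq b)"

definition phi :: "(complex \<Rightarrow> real^4) \<Rightarrow> complex \<Rightarrow> real" where
  "phi f z = (THE t. 0 \<le> t \<and> norm (alpha f z) = 2 * sinh t \<and> norm (beta f z) = 2 * cosh t)"

(* nrm and mu are meaningful only where phi is positive: the factor csch (2 * phi) becomes
   inverse 0 = 0 elsewhere. *)
definition nrm :: "(complex \<Rightarrow> real^4) \<Rightarrow> complex \<Rightarrow> real^4" where
  "nrm f z = (1/2 * inverse (sinh (2 * phi f z))) *\<^sub>R
               (f z \<odot> imq (cross3 (alpha f z) (beta f z)))"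

definition mu :: "(complex \<Rightarrow> real^4) \<Rightarrow> complex \<Rightarrow> complex" where
  "mu f z = cdot (del (del (\<lambda>w. cvec (f w))) z) (cvec (nrm f z))"

(* This is the form of the transform that makes sense also where alpha vanishes; sech is
   inverse cosh.  Where phi is positive it equals
   (eps i / 2) sech^2 phi (del f - delbar f) + tanh phi * nrm f. *)
definition transform :: "real \<Rightarrow> (complex \<Rightarrow> real^4) \<Rightarrow> complex \<Rightarrow> real^4" where
  "transform eps f z = (1/2 * (inverse (cosh (phi f z)))\<^sup>2) *\<^sub>R
     (f z \<odot> imq (eps *\<^sub>R beta f z + (1/2) *\<^sub>R cross3 (alpha f z) (beta f z)))"

(* The two transforms are mutually inverse on S, so iterating them separately in the two
   directions satisfies both recursions on S. *)
definition assoc_seq :: "(complex \<Rightarrow> real^4) \<Rightarrow> int \<Rightarrow> complex \<Rightarrow> real^4" where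
  "assoc_seq f p =
     (if 0 \<le> p then (transform 1 ^^ nat p) f else (transform (-1) ^^ nat (- p)) f)"

definition congruent_on :: "(complex \<Rightarrow> real^4) \<Rightarrow> (complex \<Rightarrow> real^4) \<Rightarrow> complex set \<Rightarrow> bool" where
  "congruent_on f g S \<longleftrightarrow> (\<exists>R. orthogonal_transformation R \<and> (\<forall>z\<in>S. g z = R (f z)))"

end

theory Submission
  imports Defs
begin

text \<open>Write \<open>E\<^sub>1 = f\<^sub>x / (2 sinh \<phi>)\<close>, \<open>E\<^sub>2 = f\<^sub>y / (2 cosh \<phi>)\<close> and \<open>\<mu> = (h\<^sub>1\<^sub>1 - i h\<^sub>1\<^sub>2) / 2\<close>. The derivatives of the frame
  \<open>f, E\<^sub>1, E\<^sub>2, N\<close> are expressed by \<open>\<phi>\<close>, its partial derivatives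
    and \<open>\<mu>\<close>; the Gauss equation says that
  \<open>\<bar>\<mu>\<bar> = sinh 2\<phi>\<close> if \<open>\<phi>\<close> is constant,
    and the Codazzi equations relate \<open>\<mu>\<close> being constant to \<open>\<phi>\<close> being
  constant. Differentiating the transform gives \<open>sinh \<phi>\<^sup>\<epsilon> = sech \<phi> \<bar>2 \<partial>\<phi> + \<epsilon> i \<mu>\<bar> / 2\<close>, and wherever \<open>\<phi>\<^sup>\<epsilon> = \<phi>\<close> it
  gives \<open>\<mu>\<^sup>\<epsilon> = \<mu> - 4 \<epsilon> i \<partial>\<phi>\<close>. So \<open>\<phi>\<^sup>\<epsilon> = \<phi>\<close> and \<open>\<mu>\<^sup>\<epsilon> = \<mu>\<close> force \<open>\<phi>\<close> to be constant, while \<open>\<mu>\<^sup>\<epsilon> = - \<mu>\<close>, the effect of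
  an orientation reversing congruence, would give \<open>\<phi>\<^sup>\<epsilon> = 0\<close>. Conversely, if \<open>\<phi>\<close> is constant, the frames of
  \<open>f\<close> and \<open>f\<^sup>\<epsilon>\<close> satisfy the same linear system. Constancy of \<open>\<phi>\<close> depends neither on \<open>\<epsilon>\<close> nor on the
  representative of a congruence class, so it propagates along the sequence.\<close>

section \<open>Partial derivatives in a complex coordinate\<close>

text \<open>Unlike \<open>dx\<close> and \<open>dy\<close>, which take a value for every function,
  this asserts differentiability together with both partials, so that the product and chain rules
  can be composed directly.\<close>

definition has_partials ::
    "(complex \<Rightarrow> 'b::real_normed_vector) \<Rightarrow> 'b \<Rightarrow> 'b \<Rightarrow> complex \<Rightarrow> bool" where
  "has_partials F a b z \<longleftrightarrow> (F has_derivative (\<lambda>h. Re h *\<^sub>R a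
    + Im h *\<^sub>R b)) (at z)"

lemma has_partials_dx: "has_partials F a b z \<Longrightarrow> dx F z = a"
  and has_partials_dy: "has_partials F a b z \<Longrightarrow> dy F z = b"
  unfolding has_partials_def dx_def dy_def
  by (simp_all flip: frechet_derivative_at)

lemma has_partials_unique:
  assumes "has_partials F a b z" "has_partials F a' b' z" shows "a = a'" "b = b'"
  using has_partials_dx[OF assms(1)] has_partials_dx[OF assms(2)]
    has_partials_dy[OF assms(1)] has_partials_dy[OF assms(2)] by auto

lemma has_partials_differentiable: "has_partials F a b z \<Longrightarrow> F differentiable (at z)"
  unfolding has_partials_def differentiable_def by blast

lemma differentiable_has_partials:
  assumes "F differentiable (at z)" shows "has_partials F (dx F z) (dy F z) z"
proof -
  let ?D = "frechet_derivative F (at z)"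
  have D: "(F has_derivative ?D) (at z)"
    using assms frechet_derivative_works by blast
  interpret bounded_linear ?D using D by (rule has_derivative_bounded_linear)
  have "?D h = Re h *\<^sub>R dx F z + Im h *\<^sub>R dy F z" for h
  proof -
    have "h = Re h *\<^sub>R 1 + Im h *\<^sub>R \<i>" by (simp add: complex_eq_iff)
    then have "?D h = ?D (Re h *\<^sub>R 1 + Im h *\<^sub>R \<i>)" by simp
    then show ?thesis by (simp add: add scaleR dx_def dy_def)
  qed
  then have "?D = (\<lambda>h. Re h *\<^sub>R dx F z + Im h *\<^sub>R dy F z)" by (rule ext)
  then show ?thesis using D by (simp add: has_partials_def)
qed

lemma has_partials_cong:
  assumes "has_partials F a b z" "open S" "z \<in> S" "\<And>w. w \<in> S \<Longrightarrow> F w = G w"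
  shows "has_partials G a b z"
  using assms has_derivative_transform_within_open unfolding has_partials_def by blast

lemma vector_divide_solve: "k \<noteq> 0 \<Longrightarrow> k *\<^sub>R v = w \<Longrightarrow> v = (1 / k) *\<^sub>R (w::'a::real_vector)"
  by auto

lemma has_partials_const: "has_partials (\<lambda>w. c) 0 0 z"
  by (simp add: has_partials_def)

lemma has_partials_add:
  "has_partials F a b z \<Longrightarrow> has_partials G c d z \<Longrightarrow> has_partials (\<lambda>w. F w
    + G w) (a + c) (b + d) z"
  unfolding has_partials_def
  by (drule (1) has_derivative_add) (simp add: algebra_simps)

lemma has_partials_linear:
  assumes "bounded_linear L" "has_partials F a b z"
  shows "has_partials (\<lambda>w. L (F w)) (L a) (L b) z"
proof -
  interpret bounded_linear L by fact
  show ?thesis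
    using has_derivative[OF assms(2)[unfolded has_partials_def]] by (simp add: has_partials_def add scaleR)
qed

lemma has_partials_minus: "has_partials F a b z \<Longrightarrow> has_partials (\<lambda>w. - F w) (- a) (- b) z"
  by (rule has_partials_linear) (auto intro: bounded_linear_minus bounded_linear_ident)

lemma has_partials_diff:
  "has_partials F a b z \<Longrightarrow> has_partials G c d z \<Longrightarrow> has_partials (\<lambda>w. F w - G w) (a - c) (b - d) z"
  using has_partials_add[of F a b z "\<lambda>w. - G w" "- c" "- d"] has_partials_minus[of G c d z] by simp

lemma has_partials_bilinear:
  assumes "bounded_bilinear B" "has_partials F a b z" "has_partials G c d z"
  shows "has_partials (\<lambda>w. B (F w) (G w)) (B a (G z) + B (F z) c) (B b (G z) + B (F z) d) z"
proof -
  interpret bounded_bilinear B by fact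
  show ?thesis
    using FDERIV[OF assms(2)[unfolded has_partials_def] assms(3)[unfolded has_partials_def]]
    by (simp add: has_partials_def add_left add_right scaleR_left scaleR_right algebra_simps)
qed

lemmas has_partials_mult = has_partials_bilinear[OF bounded_bilinear_mult]
lemmas has_partials_inner = has_partials_bilinear[OF bounded_bilinear_inner]
lemmas has_partials_scaleR = has_partials_bilinear[OF bounded_bilinear_scaleR]

lemma has_partials_cmult: "has_partials F a b z \<Longrightarrow> has_partials (\<lambda>w. (k::real) * F w) (k * a) (k * b) z"
  using has_partials_mult[OF has_partials_const[of k]] by simp

lemma has_partials_chain:
  fixes F :: "complex \<Rightarrow> real"
  assumes "(r has_field_derivative D) (at (F z))" "has_partials F a b z"
  shows "has_partials (\<lambda>w. r (F w)) (D * a) (D * b) z"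
  using has_derivative_compose[OF assms(2)[unfolded has_partials_def] assms(1)[unfolded has_field_derivative_def]]
  by (simp add: has_partials_def algebra_simps)

text \<open>The product rule for a constant inner product. Differentiating the orthogonality
  relations of a frame in this way yields the coefficients of its derivatives.\<close>

lemma has_partials_inner_const:
  assumes "open S" "z \<in> S" "\<And>w. w \<in> S \<Longrightarrow> F w \<bullet> G w = k"
    "has_partials F a b z" "has_partials G c d z"
  shows "a \<bullet> G z + F z \<bullet> c = 0" "b \<bullet> G z + F z \<bullet> d = 0"
proof -
  have "has_partials (\<lambda>w. F w \<bullet> G w) 0 0 z"
    by (rule has_partials_cong[OF has_partials_const assms(1,2)]) (use assms(3) in auto)
  from has_partials_unique[OF has_partials_inner[OF assms(4,5)] this]
  show "a \<bullet> G z + F z \<bullet> c = 0" "b \<bullet> G z + F z \<bullet> d = 0" by auto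
qed

lemma has_partials_zero_constant:
  fixes F :: "complex \<Rightarrow> 'b::real_normed_vector"
  assumes "open S" "connected S" "\<And>z. z \<in> S \<Longrightarrow> has_partials F 0 0 z" "x \<in> S" "y \<in> S"
  shows "F x = F y"
  by (rule has_derivative_zero_unique_connected[OF assms(1,2) _ assms(4,5)])
    (use assms(3) in \<open>auto simp: has_partials_def\<close>)

text \<open>The second difference is symmetric in the two directions, whereas the mean value theorem,
  applied in the first direction only, identifies its leading term.\<close>

lemma second_difference_tendsto:
  fixes F :: "'a::real_normed_vector \<Rightarrow> real"
  assumes S: "open S" "z \<in> S" and F: "\<And>w. w \<in> S \<Longrightarrow> (F has_derivative D w) (at w)"
    and A: "((\<lambda>w. D w d) has_derivative A) (at z)"
  shows "((\<lambda>t. (F (z + t *\<^sub>R d + t *\<^sub>R e) - F (z + t *\<^sub>R d) - F (z + t *\<^sub>R e)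
    + F z) / t\<^sup>2)
           \<longlongrightarrow> A e) (at_right 0)"
proof (rule tendstoI)
  fix \<epsilon>0 :: real assume "0 < \<epsilon>0"
  define K where "K = norm d + norm e + 1"
  have K: "0 < K" "norm d \<le> K" "norm e \<le> K" "norm d + norm e \<le> K" by (auto simp: K_def add_nonneg_pos)
  \<comment> \<open>Two linearisation errors, each at most \<open>\<epsilon> * (t * K)\<close>, then
    add up to \<open>t * \<epsilon>0 / 2\<close>.\<close>
  define \<epsilon> where "\<epsilon> = \<epsilon>0 / (4 * K)"
  have \<epsilon>: "0 < \<epsilon>" using \<open>0 < \<epsilon>0\<close> K by (simp add: \<epsilon>_def)
  obtain r where r: "0 < r" "ball z r \<subseteq> S" using S openE by blast
  interpret A: bounded_linear A using A by (rule has_derivative_bounded_linear)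
  obtain \<delta> where \<delta>: "0 < \<delta>"
    "\<And>w. norm (w - z) < \<delta> \<Longrightarrow> \<bar>D w d - D z d - A (w - z)\<bar> \<le> \<epsilon> * norm (w - z)"
    using A \<epsilon> unfolding has_derivative_at_alt real_norm_def by blast
  define T where "T = min r \<delta> / K"
  have T: "0 < T" using r \<delta> K by (simp add: T_def)
  have "dist ((F (z + t *\<^sub>R d + t *\<^sub>R e) - F (z + t *\<^sub>R d) - F (z + t *\<^sub>R e)
    + F z) / t\<^sup>2) (A e) < \<epsilon>0"
    if t: "0 < t" "t < T" for t
  proof -
    have tK: "t * K < r" "t * K < \<delta>" using t K by (auto simp: T_def field_simps)
    have n1: "norm (\<xi> *\<^sub>R d + t *\<^sub>R e) \<le> t * K" "norm (\<xi> *\<^sub>R d) \<le> t * K" if \<xi>: "0 \<le> \<xi>" "\<xi> \<le> t" for \<xi>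
    proof -
      have "norm (\<xi> *\<^sub>R d + t *\<^sub>R e) \<le> \<xi> * norm d + t * norm e"
        using \<xi> t by (intro norm_triangle_le) auto
      also have "\<dots> \<le> t * norm d + t * norm e" using \<xi> by (simp add: mult_right_mono)
      also have "\<dots> \<le> t * K" using t K(4) by (simp flip: distrib_left)
      finally show "norm (\<xi> *\<^sub>R d + t *\<^sub>R e) \<le> t * K" .
      show "norm (\<xi> *\<^sub>R d) \<le> t * K" using \<xi> t K by (simp add: mult_mono)
    qed
    have inS: "z + \<xi> *\<^sub>R d + t *\<^sub>R e \<in> S" "z
      + \<xi> *\<^sub>R d \<in> S" if \<xi>: "0 \<le> \<xi>" "\<xi> \<le> t" for \<xi>
      using n1[OF \<xi>] tK r(2) by (auto simp: subset_iff dist_norm add.assoc norm_minus_commute)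
    \<comment> \<open>The increment by \<open>t *\<^sub>R e\<close> as a function of the position
      along \<open>d\<close>; its change between 0 and \<open>t\<close> is the second
      difference.\<close>
    define \<Phi> where "\<Phi> \<xi> = F (z + \<xi> *\<^sub>R d + t *\<^sub>R e) - F (z
      + \<xi> *\<^sub>R d)" for \<xi>
    have der: "(\<Phi> has_derivative (\<lambda>h. h * (D (z + \<xi> *\<^sub>R d + t *\<^sub>R e) d - D (z
      + \<xi> *\<^sub>R d) d))) (at \<xi>)"
      if \<xi>: "0 \<le> \<xi>" "\<xi> \<le> t" for \<xi>
    proof -
      have l: "((\<lambda>\<xi>. z + \<xi> *\<^sub>R d + t *\<^sub>R e) has_derivative (\<lambda>h. h *\<^sub>R d)) (at \<xi>)"
        "((\<lambda>\<xi>. z + \<xi> *\<^sub>R d) has_derivative (\<lambda>h. h *\<^sub>R d)) (at \<xi>)"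
        by (auto intro!: derivative_eq_intros)
      note D = F[OF inS(1)[OF \<xi>]] F[OF inS(2)[OF \<xi>]]
      have "(\<Phi> has_derivative (\<lambda>h. D (z + \<xi> *\<^sub>R d + t *\<^sub>R e) (h *\<^sub>R d) - D (z
      + \<xi> *\<^sub>R d) (h *\<^sub>R d))) (at \<xi>)"
        unfolding \<Phi>_def
        by (intro has_derivative_diff has_derivative_compose[OF l(1) D(1)] has_derivative_compose[OF l(2) D(2)])
      then show ?thesis
        using D[THEN has_derivative_linear] by (simp add: linear_cmul right_diff_distrib)
    qed
    obtain \<xi> where \<xi>: "0 < \<xi>" "\<xi> < t"
      "\<Phi> t - \<Phi> 0 = t * (D (z + \<xi> *\<^sub>R d + t *\<^sub>R e) d - D (z + \<xi> *\<^sub>R d) d)"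
      using mvt[OF t(1), of \<Phi> "\<lambda>\<xi> h. h * (D (z + \<xi> *\<^sub>R d + t *\<^sub>R e) d - D (z
      + \<xi> *\<^sub>R d) d)"]
      by (metis (no_types, lifting) der atLeastAtMost_iff continuous_at_imp_continuous_on
          diff_zero has_derivative_continuous less_imp_le)
    define x y where "x = D (z + \<xi> *\<^sub>R d + t *\<^sub>R e) d" and "y = D (z + \<xi> *\<^sub>R d) d"
    have n: "norm (\<xi> *\<^sub>R d + t *\<^sub>R e) \<le> t * K" "norm (\<xi> *\<^sub>R d) \<le> t * K"
      using n1[of \<xi>] \<xi> by auto
    have "\<bar>x - D z d - A (\<xi> *\<^sub>R d + t *\<^sub>R e)\<bar> \<le> \<epsilon> * norm (\<xi> *\<^sub>R d + t *\<^sub>R e)"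
      using \<delta>(2)[of "z + \<xi> *\<^sub>R d + t *\<^sub>R e"] n tK by (simp add: x_def add.assoc)
    moreover have "\<bar>y - D z d - A (\<xi> *\<^sub>R d)\<bar> \<le> \<epsilon> * norm (\<xi> *\<^sub>R d)"
      using \<delta>(2)[of "z + \<xi> *\<^sub>R d"] n tK by (simp add: y_def)
    moreover have "\<epsilon> * norm (\<xi> *\<^sub>R d + t *\<^sub>R e) \<le> \<epsilon> * (t * K)" "\<epsilon> * norm (\<xi> *\<^sub>R d) \<le> \<epsilon> * (t * K)"
      using n \<epsilon> by (simp_all only: mult_left_mono less_imp_le)
    \<comment> \<open>The terms \<open>A (\<xi> *\<^sub>R d)\<close> cancel, so the unknown
      intermediate point drops out.\<close>
    ultimately have "\<bar>x - y - t * A e\<bar> \<le> 2 * (\<epsilon> * (t * K))"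
      unfolding A.add A.scaleR by simp
    also have "2 * (\<epsilon> * (t * K)) < t * \<epsilon>0"
      using K \<open>0 < \<epsilon>0\<close> t by (simp add: \<epsilon>_def)
    finally have lt: "\<bar>x - y - t * A e\<bar> < t * \<epsilon>0" .
    have eq: "F (z + t *\<^sub>R d + t *\<^sub>R e) - F (z + t *\<^sub>R d) - F (z + t *\<^sub>R e)
      + F z = t * (x - y)"
      using \<xi>(3) by (simp add: \<Phi>_def x_def y_def)
    have "t * (x - y) / t\<^sup>2 - A e = (x - y - t * A e) / t"
      using t by (simp add: field_simps power2_eq_square)
    moreover have "\<bar>(x - y - t * A e) / t\<bar> < \<epsilon>0"
      using lt t by (simp add: abs_divide divide_less_eq mult.commute)
    ultimately show ?thesis by (simp only: eq dist_real_def)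
  qed
  then show "\<forall>\<^sub>F t in at_right 0.
      dist ((F (z + t *\<^sub>R d + t *\<^sub>R e) - F (z + t *\<^sub>R d) - F (z + t *\<^sub>R e)
      + F z) / t\<^sup>2) (A e) < \<epsilon>0"
    using T by (auto simp: eventually_at_right_field)
qed

text \<open>Pairing with \<open>v\<close> reduces to real functions, where the mean value theorem is
  available. The second difference in the directions 1 and \<open>\<i>\<close> then tends to both
  mixed derivatives. Differentiability of the first partials at the single point \<open>z\<close>
  suffices.\<close>

lemma partials_commute:
  fixes F :: "complex \<Rightarrow> 'b::real_inner"
  assumes S: "open S" "z \<in> S" and F: "\<And>w. w \<in> S \<Longrightarrow> has_partials F (a w) (b w) w"
    and a: "has_partials a a1 a2 z" and b: "has_partials b b1 b2 z"
  shows "a2 = b1"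
proof -
  have "a2 \<bullet> v = b1 \<bullet> v" for v
  proof -
    have L: "bounded_linear (\<lambda>u. u \<bullet> v)" by (rule bounded_linear_inner_left)
    define D where "D = (\<lambda>w h. Re h *\<^sub>R (a w \<bullet> v) + Im h *\<^sub>R (b w \<bullet> v))"
    define \<Delta> where "\<Delta> = (\<lambda>t::real. (F (z + t *\<^sub>R 1
      + t *\<^sub>R \<i>) \<bullet> v - F (z + t *\<^sub>R 1) \<bullet> v - F (z + t *\<^sub>R \<i>) \<bullet> v
      + F z \<bullet> v) / t\<^sup>2)"
    have D: "((\<lambda>w. F w \<bullet> v) has_derivative D w) (at w)" if "w \<in> S" for w
      using has_partials_linear[OF L F[OF that]] by (simp add: has_partials_def D_def)
    have D1: "((\<lambda>w. D w 1) has_derivative (\<lambda>h. Re h *\<^sub>R (a1 \<bullet> v)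
      + Im h *\<^sub>R (a2 \<bullet> v))) (at z)"
      using has_partials_linear[OF L a] by (simp add: has_partials_def D_def)
    have D2: "((\<lambda>w. D w \<i>) has_derivative (\<lambda>h. Re h *\<^sub>R (b1 \<bullet> v)
      + Im h *\<^sub>R (b2 \<bullet> v))) (at z)"
      using has_partials_linear[OF L b] by (simp add: has_partials_def D_def)
    have "(\<Delta> \<longlongrightarrow> a2 \<bullet> v) (at_right 0)"
      using second_difference_tendsto[OF S D D1, of \<i>] by (simp add: \<Delta>_def)
    moreover have "(\<Delta> \<longlongrightarrow> b1 \<bullet> v) (at_right 0)"
      using second_difference_tendsto[OF S D D2, of 1] by (simp add: \<Delta>_def algebra_simps)
    ultimately show ?thesis using tendsto_unique trivial_limit_at_right_real by blast
  qed
  then show ?thesis by (metis vector_eq_rdot)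
qed

section \<open>Quaternions and oriented orthonormal frames\<close>

lemmas real4_simps = qmult_def imq_def vec_eq_iff forall_4 inner_vec_def sum_4

lemma vector_4' [simp]:
  "(vector [a, b, c, d] :: ('a::zero)^4) $ 1 = a"
  "(vector [a, b, c, d] :: ('a::zero)^4) $ 2 = b"
  "(vector [a, b, c, d] :: ('a::zero)^4) $ 3 = c"
  "(vector [a, b, c, d] :: ('a::zero)^4) $ 4 = d"
  by (simp_all add: vector_def)

lemma inner_qmult_imq: "q \<bullet> (q \<odot> imq v) = 0"
  by (simp add: real4_simps algebra_simps)

lemma inner_qmult_qmult: "(q \<odot> imq u) \<bullet> (q \<odot> imq v) = (q \<bullet> q) * (u \<bullet> v)"
  by (simp add: real4_simps sum_3 algebra_simps)

lemma norm_qmult_imq: "norm (q \<odot> imq v) = norm q * norm v"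
  by (simp add: norm_eq_sqrt_inner inner_qmult_qmult real_sqrt_mult)

lemma qmult_imq_diff: "q \<odot> imq u - q \<odot> imq v = q \<odot> imq (u - v)"
  by (simp add: real4_simps algebra_simps)

lemma qmult_imq_scaleR: "q \<odot> imq (k *\<^sub>R v) = k *\<^sub>R (q \<odot> imq v)"
  by (simp add: real4_simps algebra_simps)

lemma qmult_imq_add: "q \<odot> imq (u + v) = q \<odot> imq u + q \<odot> imq v"
  by (simp add: real4_simps algebra_simps)

text \<open>The products of a unit quaternion \<open>q\<close> with imaginary quaternions are
  exactly the tangent vectors of the sphere at \<open>q\<close>. This makes the definite
  descriptions in \<open>alpha\<close> and \<open>beta\<close> well defined.\<close>

lemma ex1_qmult_imq:
  assumes "norm q = 1" "q \<bullet> w = 0" shows "\<exists>!a. w = q \<odot> imq a"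
proof
  \<comment> \<open>The imaginary part of the conjugate of \<open>q\<close> times \<open>w\<close>;
    the real part of that product is \<open>q \<bullet> w\<close>, hence zero.\<close>
  let ?a = "vector [q$1 * w$2 - q$2 * w$1 - q$3 * w$4 + q$4 * w$3,
                    q$1 * w$3 + q$2 * w$4 - q$3 * w$1 - q$4 * w$2,
                    q$1 * w$4 - q$2 * w$3 + q$3 * w$2 - q$4 * w$1] :: real^3"
  have 1: "q \<bullet> q = 1" using assms(1) by (simp add: norm_eq_1)
  have "q \<odot> imq ?a = (q \<bullet> q) *\<^sub>R w - (q \<bullet> w) *\<^sub>R q"
    by (simp add: real4_simps algebra_simps)
  then show "w = q \<odot> imq ?a" by (simp add: 1 assms(2))
  show "a = ?a" if "w = q \<odot> imq a" for a
  proof -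
    have "norm (q \<odot> imq (a - ?a)) = 0"
      using that \<open>w = q \<odot> imq ?a\<close> by (simp flip: qmult_imq_diff)
    then show ?thesis by (simp add: norm_qmult_imq assms(1))
  qed
qed

text \<open>Characterised by \<open>cross4 a b c \<bullet> d = det [a, b, c, d]\<close>: this expresses \<open>f \<odot> imq (\<alpha> \<times> \<beta>)\<close> through
  \<open>f\<close>, \<open>f\<^sub>x\<close>, \<open>f\<^sub>y\<close> without quaternions.\<close>

definition cross4 :: "real^4 \<Rightarrow> real^4 \<Rightarrow> real^4 \<Rightarrow> real^4" where
  "cross4 a b c = vector
     [- (a$2 * (b$3 * c$4 - b$4 * c$3) - a$3 * (b$2 * c$4 - b$4 * c$2) + a$4 * (b$2 * c$3 - b$3 * c$2)),
      a$1 * (b$3 * c$4 - b$4 * c$3) - a$3 * (b$1 * c$4 - b$4 * c$1) + a$4 * (b$1 * c$3 - b$3 * c$1),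
      - (a$1 * (b$2 * c$4 - b$4 * c$2) - a$2 * (b$1 * c$4 - b$4 * c$1) + a$4 * (b$1 * c$2 - b$2 * c$1)),
      a$1 * (b$2 * c$3 - b$3 * c$2) - a$2 * (b$1 * c$3 - b$3 * c$1) + a$3 * (b$1 * c$2 - b$2 * c$1)]"

text \<open>For \<open>q = 1\<close> this is the vector product of the imaginary parts. Left
  multiplication by a unit quaternion is a rotation and carries this case to any unit
  \<open>q\<close>; the factor \<open>q \<bullet> q\<close> accounts for homogeneity.\<close>

lemma cross4_quaternion:
  "cross4 q (q \<odot> imq u) (q \<odot> imq v) = (q \<bullet> q) *\<^sub>R (q \<odot> imq (cross3 u v))"
  by (simp add: real4_simps cross4_def cross3_def algebra_simps)

lemma cross4_linear:
  "cross4 (a + a') b c = cross4 a b c + cross4 a' b c"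
  "cross4 a (b + b') c = cross4 a b c + cross4 a b' c"
  "cross4 a b (c + c') = cross4 a b c + cross4 a b c'"
  "cross4 (k *\<^sub>R a) b c = k *\<^sub>R cross4 a b c"
  "cross4 a (k *\<^sub>R b) c = k *\<^sub>R cross4 a b c"
  "cross4 a b (k *\<^sub>R c) = k *\<^sub>R cross4 a b c"
  by (simp_all add: real4_simps cross4_def algebra_simps)

lemma cross4_alternating:
  "cross4 a a c = 0" "cross4 a b b = 0" "cross4 a b a = 0"
  "cross4 a b c \<bullet> d = - (cross4 a b d \<bullet> c)"
  by (simp_all add: real4_simps cross4_def algebra_simps)

section \<open>Orthonormal frames of four-space and their orientation\<close>

definition orthonormal4 :: "real^4 \<Rightarrow> real^4 \<Rightarrow> real^4 \<Rightarrow> real^4 \<Rightarrow> bool" where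
  "orthonormal4 a b c d \<longleftrightarrow>
     a \<bullet> a = 1 \<and> b \<bullet> b = 1 \<and> c \<bullet> c = 1 \<and> d \<bullet> d = 1 \<and>
     a \<bullet> b = 0 \<and> a \<bullet> c = 0 \<and> a \<bullet> d = 0 \<and> b \<bullet> c = 0 \<and> b \<bullet> d = 0 \<and> c \<bullet> d = 0"

lemma orthonormal4_expand:
  assumes "orthonormal4 a b c d"
  shows "v = (v \<bullet> a) *\<^sub>R a + (v \<bullet> b) *\<^sub>R b + (v \<bullet> c) *\<^sub>R c
    + (v \<bullet> d) *\<^sub>R d"
proof -
  note o = assms[unfolded orthonormal4_def]
  have ne: "a \<noteq> b" "a \<noteq> c" "a \<noteq> d" "b \<noteq> c" "b \<noteq> d" "c \<noteq> d" using o by auto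
  have 0: "a \<noteq> 0" "b \<noteq> 0" "c \<noteq> 0" "d \<noteq> 0" using o by auto
  let ?B = "{a, b, c, d}"
  have orth: "pairwise orthogonal ?B"
    using o by (auto simp: pairwise_def orthogonal_def inner_commute)
  have "independent ?B" using orth 0 by (intro pairwise_orthogonal_independent) auto
  moreover have "card ?B = DIM(real^4)" using ne by simp
  ultimately have "span ?B = UNIV"
    by (metis card_eq_dim dim_UNIV finite.emptyI finite.insertI span_UNIV span_eq_dim subset_UNIV
        card_ge_dim_independent order_refl top.extremum_uniqueI)
  then have "(\<Sum>x\<in>?B. (v \<bullet> x) *\<^sub>R x) = v"
    using o by (intro orthonormal_basis_expand[OF orth]) (auto simp: norm_eq_1)
  then show ?thesis using ne by (simp add: add.assoc inner_commute)
qed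

lemma orthonormal4_eqI:
  assumes "orthonormal4 a b c d" "v \<bullet> a = w \<bullet> a" "v \<bullet> b = w \<bullet> b" "v \<bullet> c = w \<bullet> c" "v \<bullet> d = w \<bullet> d"
  shows "v = w"
  using orthonormal4_expand[OF assms(1), of v] orthonormal4_expand[OF assms(1), of w] assms(2-)
  by simp

text \<open>Writing \<open>b\<close> and \<open>c\<close> as \<open>a\<close> times imaginary units
  reduces the length of the last vector to that of the vector product of two orthonormal vectors of
  three-space.\<close>

lemma orthonormal4_cross4:
  assumes "a \<bullet> a = 1" "b \<bullet> b = 1" "c \<bullet> c = 1" "a \<bullet> b = 0" "a \<bullet> c = 0" "b \<bullet> c = 0"
  shows "orthonormal4 a b c (cross4 a b c)"
proof -
  have "norm a = 1" using assms by (simp add: norm_eq_1)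
  then obtain u v where uv: "b = a \<odot> imq u" "c = a \<odot> imq v"
    using ex1_qmult_imq[OF _ assms(4)] ex1_qmult_imq[OF _ assms(5)] by blast
  have i: "u \<bullet> u = 1" "v \<bullet> v = 1" "u \<bullet> v = 0"
    using assms by (simp_all add: uv inner_qmult_qmult)
  have "cross4 a b c \<bullet> cross4 a b c = cross3 u v \<bullet> cross3 u v"
    by (simp add: uv cross4_quaternion assms(1) inner_qmult_qmult)
  also have "\<dots> = 1" using norm_cross[of u v] i by (simp add: power2_norm_eq_inner)
  finally have n: "cross4 a b c \<bullet> cross4 a b c = 1" .
  have "cross4 a b c \<bullet> a = 0" "cross4 a b c \<bullet> b = 0" "cross4 a b c \<bullet> c = 0"
    by (simp_all add: real4_simps cross4_def algebra_simps)
  then show ?thesis using n assms by (simp add: orthonormal4_def inner_commute)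
qed

text \<open>The frame is positively oriented: its determinant
  \<open>cross4 a b c \<bullet> d\<close> is 1. Permuting the columns gives the one coefficient of
  each product that orthogonality leaves open.\<close>

lemma cross4_orthonormal:
  assumes "orthonormal4 a b c d" "d = cross4 a b c"
  shows "cross4 a b d = - c" "cross4 a c d = b" "cross4 b c d = - a"
proof -
  note o = assms(1)[unfolded orthonormal4_def]
  have D: "cross4 a b d \<bullet> c = -1" "cross4 a c d \<bullet> b = 1" "cross4 b c d \<bullet> a = -1"
  proof -
    have 1: "cross4 a b c \<bullet> d = 1" using o assms(2) by simp
    show "cross4 a b d \<bullet> c = -1" using 1 cross4_alternating(4)[of a b c d] by simp
    have "cross4 a c d \<bullet> b = cross4 a b c \<bullet> d"
      by (simp add: real4_simps cross4_def algebra_simps)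
    then show "cross4 a c d \<bullet> b = 1" using 1 by simp
    have "cross4 b c d \<bullet> a = - (cross4 a b c \<bullet> d)"
      by (simp add: real4_simps cross4_def algebra_simps)
    then show "cross4 b c d \<bullet> a = -1" using 1 by simp
  qed
  have z: "cross4 x y w \<bullet> x = 0" "cross4 x y w \<bullet> y = 0" "cross4 x y w \<bullet> w = 0" for x y w
    by (simp_all add: real4_simps cross4_def algebra_simps)
  show "cross4 a b d = - c" "cross4 a c d = b" "cross4 b c d = - a"
    by (rule orthonormal4_eqI[OF assms(1)]; use o D z in \<open>simp add: inner_commute\<close>)+
qed

lemma differentiable_cross4:
  fixes F G H :: "complex \<Rightarrow> real^4"
  assumes "F differentiable (at z)" "G differentiable (at z)" "H differentiable (at z)"
  shows "(\<lambda>w. cross4 (F w) (G w) (H w)) differentiable (at z)"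
proof -
  have "(\<lambda>w. E w $ i) differentiable (at z)" if "E differentiable (at z)" for E :: "complex \<Rightarrow> real^4" and i
    using that bounded_linear.has_derivative[OF bounded_linear_vec_nth] unfolding differentiable_def by blast
  note c = this[OF assms(1)] this[OF assms(2)] this[OF assms(3)]
  have "\<forall>i. (\<lambda>w. cross4 (F w) (G w) (H w) $ i) differentiable (at z)"
    unfolding forall_4 cross4_def vector_4'
    by (intro conjI differentiable_add differentiable_diff differentiable_minus differentiable_mult c)
  then show ?thesis
    by (subst differentiable_componentwise_within) (auto simp: Basis_vec_def inner_axis)
qed

section \<open>The invariants \<open>alpha\<close>, \<open>beta\<close>, \<open>phi\<close> and the
  normal in terms of partial derivatives\<close>

lemma alpha_eqI:
  assumes "norm (g z) = 1" "dx g z = g z \<odot> imq a" shows "alpha g z = a"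
  unfolding alpha_def
  by (rule the1_equality[OF ex1_qmult_imq]) (use assms in \<open>auto simp: inner_qmult_imq\<close>)

lemma beta_eqI:
  assumes "norm (g z) = 1" "dy g z = g z \<odot> imq b" shows "beta g z = b"
  unfolding beta_def
  by (rule the1_equality[OF ex1_qmult_imq]) (use assms in \<open>auto simp: inner_qmult_imq\<close>)

lemma
  assumes "norm (g z) = 1" "g z \<bullet> dx g z = 0"
  shows qmult_alpha: "g z \<odot> imq (alpha g z) = dx g z"
    and norm_alpha: "norm (alpha g z) = norm (dx g z)"
proof -
  from ex1_qmult_imq[OF assms] obtain a where a: "dx g z = g z \<odot> imq a" by blast
  show "g z \<odot> imq (alpha g z) = dx g z" using alpha_eqI[OF assms(1) a] a by simp
  then show "norm (alpha g z) = norm (dx g z)" using norm_qmult_imq[of "g z"] assms(1) by (metis mult_1)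
qed

lemma
  assumes "norm (g z) = 1" "g z \<bullet> dy g z = 0"
  shows qmult_beta: "g z \<odot> imq (beta g z) = dy g z"
    and norm_beta: "norm (beta g z) = norm (dy g z)"
proof -
  from ex1_qmult_imq[OF assms] obtain a where a: "dy g z = g z \<odot> imq a" by blast
  show "g z \<odot> imq (beta g z) = dy g z" using beta_eqI[OF assms(1) a] a by simp
  then show "norm (beta g z) = norm (dy g z)" using norm_qmult_imq[of "g z"] assms(1) by (metis mult_1)
qed

lemma qmult_cross3_alpha_beta:
  assumes "norm (g z) = 1" "g z \<bullet> dx g z = 0" "g z \<bullet> dy g z = 0"
  shows "g z \<odot> imq (cross3 (alpha g z) (beta g z)) = cross4 (g z) (dx g z) (dy g z)"
  using cross4_quaternion[of "g z" "alpha g z" "beta g z"] assms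
  by (simp add: qmult_alpha qmult_beta norm_eq_1)

lemma phi_eqI:
  assumes "norm (g z) = 1" "g z \<bullet> dx g z = 0" "g z \<bullet> dy g z = 0"
    and "0 \<le> t" "norm (dx g z) = 2 * sinh t" "norm (dy g z) = 2 * cosh t"
  shows "phi g z = t"
  unfolding phi_def norm_alpha[of g z, OF assms(1,2)] norm_beta[of g z, OF assms(1,3)]
  by (rule the_equality) (use assms in auto)

section \<open>Complexified derivatives\<close>

lemma bounded_linear_cvec: "bounded_linear (cvec :: real^'n \<Rightarrow> complex^'n)"
  by (rule linear_conv_bounded_linear[THEN iffD1], rule linearI) (simp_all add: cvec_def vec_eq_iff scaleR_conv_of_real[where 'a=complex])

lemma bounded_linear_smult: "bounded_linear ((*s) k :: complex^'n \<Rightarrow> complex^'n)"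
  by (rule linear_conv_bounded_linear[THEN iffD1], rule linearI)
    (simp_all add: vec_eq_iff scaleR_conv_of_real[where 'a=complex] algebra_simps)

lemma cdot_linear:
  "cdot (u + v) w = cdot u w + cdot v w" "cdot (u - v) w = cdot u w - cdot v w"
  "cdot w (u + v) = cdot w u + cdot w v" "cdot w (u - v) = cdot w u - cdot w v"
  "cdot (k *s u) w = k * cdot u w" "cdot w (k *s u) = k * cdot w u"
  by (simp_all add: cdot_def sum.distrib sum_subtractf sum_distrib_left algebra_simps)

lemma cdot_cvec: "cdot (cvec u) (cvec v) = of_real (u \<bullet> v)"
  by (simp add: cdot_def cvec_def inner_vec_def)

lemma has_partials_del: "has_partials F a b z \<Longrightarrow> del F z = (1/2) *s (a - \<i> *s b)"
  and has_partials_delbar: "has_partials F a b z \<Longrightarrow> delbar F z = (1/2) *s (a + \<i> *s b)"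
  by (simp_all add: del_def delbar_def has_partials_dx has_partials_dy)

lemma has_partials_cvec: "has_partials F a b z \<Longrightarrow> has_partials (\<lambda>w. cvec (F w)) (cvec a) (cvec b) z"
  by (rule has_partials_linear[OF bounded_linear_cvec])

lemma has_partials_smult:
  fixes F :: "complex \<Rightarrow> complex^'n"
  shows "has_partials F a b z \<Longrightarrow> has_partials (\<lambda>w. k *s F w) (k *s a) (k *s b) z"
  by (rule has_partials_linear[OF bounded_linear_smult])

lemma
  assumes "f differentiable (at z)"
  shows del_cvec: "del (\<lambda>w. cvec (f w)) z = (1/2) *s (cvec (dx f z) - \<i> *s cvec (dy f z))"
    and delbar_cvec: "delbar (\<lambda>w. cvec (f w)) z = (1/2) *s (cvec (dx f z) + \<i> *s cvec (dy f z))"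
  using has_partials_cvec[OF differentiable_has_partials[OF assms]]
  by (simp_all add: has_partials_del has_partials_delbar)

lemma
  assumes "f differentiable (at z)"
  shows cdot_del_del: "cdot (del (\<lambda>w. cvec (f w)) z) (del (\<lambda>w. cvec (f w)) z) =
      (of_real (dx f z \<bullet> dx f z - dy f z \<bullet> dy f z) - 2 * \<i> * of_real (dx f z \<bullet> dy f z)) / 4"
    and cdot_del_delbar: "cdot (del (\<lambda>w. cvec (f w)) z) (delbar (\<lambda>w. cvec (f w)) z) =
      of_real ((dx f z \<bullet> dx f z + dy f z \<bullet> dy f z) / 4)"
  unfolding del_cvec[OF assms] delbar_cvec[OF assms] cdot_linear cdot_cvec
  by (simp_all add: inner_commute field_simps)

text \<open>The mixed derivatives in the two orders are kept apart: their equality will be read off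
  from the imaginary part of the harmonic map equation.\<close>

lemma
  assumes S: "open S" "z \<in> S" and f: "\<And>w. w \<in> S \<Longrightarrow> f differentiable (at w)"
    and d: "dx f differentiable (at z)" "dy f differentiable (at z)"
  shows del_del_cvec: "del (del (\<lambda>w. cvec (f w))) z =
      (1/4) *s (cvec (dx (dx f) z - dy (dy f) z) - \<i> *s cvec (dx (dy f) z + dy (dx f) z))"
    and del_delbar_cvec: "del (delbar (\<lambda>w. cvec (f w))) z =
      (1/4) *s (cvec (dx (dx f) z + dy (dy f) z) + \<i> *s cvec (dx (dy f) z - dy (dx f) z))"
proof -
  note C = has_partials_cvec[OF differentiable_has_partials[OF d(1)]]
    has_partials_smult[OF has_partials_cvec[OF differentiable_has_partials[OF d(2)]], of \<i>]
  have "has_partials (del (\<lambda>w. cvec (f w))) ((1/2) *s (cvec (dx (dx f) z) - \<i> *s cvec (dx (dy f) z)))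
      ((1/2) *s (cvec (dy (dx f) z) - \<i> *s cvec (dy (dy f) z))) z"
    by (rule has_partials_cong[OF has_partials_smult[OF has_partials_diff[OF C]] S]) (simp add: del_cvec f)
  then show "del (del (\<lambda>w. cvec (f w))) z =
      (1/4) *s (cvec (dx (dx f) z - dy (dy f) z) - \<i> *s cvec (dx (dy f) z + dy (dx f) z))"
    by (simp add: has_partials_del vec_eq_iff cvec_def field_simps)
  have "has_partials (delbar (\<lambda>w. cvec (f w))) ((1/2) *s (cvec (dx (dx f) z) + \<i> *s cvec (dx (dy f) z)))
      ((1/2) *s (cvec (dy (dx f) z) + \<i> *s cvec (dy (dy f) z))) z"
    by (rule has_partials_cong[OF has_partials_smult[OF has_partials_add[OF C]] S]) (simp add: delbar_cvec f)
  then show "del (delbar (\<lambda>w. cvec (f w))) z =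
      (1/4) *s (cvec (dx (dx f) z + dy (dy f) z) + \<i> *s cvec (dx (dy f) z - dy (dx f) z))"
    by (simp add: has_partials_del vec_eq_iff cvec_def field_simps)
qed

section \<open>Harmonicity and adaptedness in real terms\<close>

lemma smooth_map_on_differentiable:
  assumes "smooth_map_on F S" "z \<in> S" shows "F differentiable (at z)"
  using assms Ck_on.simps(2)[of 0 F S] unfolding smooth_map_on_def by blast

lemma smooth_map_on_dx: "smooth_map_on F S \<Longrightarrow> smooth_map_on (dx F) S"
  and smooth_map_on_dy: "smooth_map_on F S \<Longrightarrow> smooth_map_on (dy F) S"
  unfolding smooth_map_on_def by (metis Ck_on.simps(2))+

text \<open>The right-hand side of the complex equation is real. The real part thus prescribes the
  Laplacian, and the imaginary part is the symmetry of the mixed derivatives.\<close>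

lemma harmonic_map_on_iff:
  assumes S: "open S"
  shows "harmonic_map_on f S \<longleftrightarrow> smooth_map_on f S \<and> (\<forall>z\<in>S. f z \<bullet> f z = 1) \<and>
    (\<forall>z\<in>S. dx (dy f) z = dy (dx f) z \<and>
       dx (dx f) z + dy (dy f) z = - (dx f z \<bullet> dx f z + dy f z \<bullet> dy f z) *\<^sub>R f z)"
proof -
  have "del (delbar (\<lambda>w. cvec (f w))) z =
        - (cdot (del (\<lambda>w. cvec (f w)) z) (delbar (\<lambda>w. cvec (f w)) z)) *s cvec (f z) \<longleftrightarrow>
      dx (dy f) z = dy (dx f) z \<and>
        dx (dx f) z + dy (dy f) z = - (dx f z \<bullet> dx f z + dy f z \<bullet> dy f z) *\<^sub>R f z"
    if "smooth_map_on f S" "z \<in> S" for z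
  proof -
    note d = smooth_map_on_differentiable[OF that(1)]
      smooth_map_on_differentiable[OF smooth_map_on_dx[OF that(1)] that(2)]
      smooth_map_on_differentiable[OF smooth_map_on_dy[OF that(1)] that(2)]
    have e: "del (delbar (\<lambda>w. cvec (f w))) z =
        (1/4) *s (cvec (dx (dx f) z + dy (dy f) z) + \<i> *s cvec (dx (dy f) z - dy (dx f) z))"
      by (rule del_delbar_cvec[OF S that(2) d])
    have r: "(1/4) * (complex_of_real a + \<i> * complex_of_real (b - b')) = - complex_of_real (k / 4) * complex_of_real t
        \<longleftrightarrow> b = b' \<and> a = - k * t" for a b b' k t
      by (auto simp: complex_eq_iff field_simps)
    show ?thesis
      unfolding e cdot_del_delbar[OF d(1)[OF that(2)]]
      unfolding vec_eq_iff all_conj_distrib[symmetric]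
        vector_smult_component vector_add_component vector_minus_component cvec_def vec_lambda_beta r
      by simp
  qed
  then show ?thesis
    unfolding harmonic_map_on_def Let_def by (auto simp: norm_eq_1)
qed

lemma adapted_on_iff:
  assumes "smooth_map_on f S"
  shows "adapted_on f S \<longleftrightarrow> (\<forall>z\<in>S. dx f z \<bullet> dx f z - dy f z \<bullet> dy f z = -4 \<and> dx f z \<bullet> dy f z = 0)"
  unfolding adapted_on_def Let_def
  by (auto simp: cdot_del_del smooth_map_on_differentiable[OF assms] complex_eq_iff)

section \<open>Structure equations of an adapted harmonic map\<close>

locale adapted_harmonic =
  fixes S :: "complex set" and f :: "complex \<Rightarrow> real^4"
  assumes S: "open S" and harmonic: "harmonic_map_on f S" and adapted: "adapted_on f S"
    and alpha_nz: "\<And>z. z \<in> S \<Longrightarrow> alpha f z \<noteq> 0"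
begin

abbreviation "fx \<equiv> dx f"
abbreviation "fy \<equiv> dy f"
abbreviation "fxx \<equiv> dx fx"
abbreviation "fxy \<equiv> dy fx"
abbreviation "fyy \<equiv> dy fy"
abbreviation "p \<equiv> phi f"
abbreviation "s z \<equiv> sinh (p z)"
abbreviation "c z \<equiv> cosh (p z)"
abbreviation "px \<equiv> dx p"
abbreviation "py \<equiv> dy p"

section \<open>The orthonormal frame along the map\<close>

definition "e1 z = (1 / (2 * s z)) *\<^sub>R fx z"
definition "e2 z = (1 / (2 * c z)) *\<^sub>R fy z"
definition "nv z = cross4 (f z) (e1 z) (e2 z)"
text \<open>Coefficients of the second fundamental form in the coordinates; the third one is
  \<open>- h11\<close> by \<open>fyy_nv\<close>.\<close>

definition "h11 z = fxx z \<bullet> nv z"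
definition "h12 z = fxy z \<bullet> nv z"

lemma smooth: "smooth_map_on f S"
  and norm_f: "z \<in> S \<Longrightarrow> f z \<bullet> f z = 1"
  and fyx: "z \<in> S \<Longrightarrow> dx fy z = fxy z"
  and laplace: "z \<in> S \<Longrightarrow> fxx z + fyy z = - (fx z \<bullet> fx z
    + fy z \<bullet> fy z) *\<^sub>R f z"
  using harmonic unfolding harmonic_map_on_iff[OF S] by blast+

lemma adapted': "z \<in> S \<Longrightarrow> fx z \<bullet> fx z - fy z \<bullet> fy z = -4" "z \<in> S \<Longrightarrow> fx z \<bullet> fy z = 0"
  using adapted adapted_on_iff[OF smooth] by auto

lemmas smooth1 = smooth_map_on_dx[OF smooth] smooth_map_on_dy[OF smooth]
lemmas smooth2 = smooth_map_on_dx[OF smooth1(1)] smooth_map_on_dy[OF smooth1(1)]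
  smooth_map_on_dx[OF smooth1(2)] smooth_map_on_dy[OF smooth1(2)]

lemma has_partials_smooth: "smooth_map_on F S \<Longrightarrow> z \<in> S \<Longrightarrow> has_partials F (dx F z) (dy F z) z"
  by (rule differentiable_has_partials[OF smooth_map_on_differentiable])

lemmas has_partials_f = has_partials_smooth[OF smooth]
lemmas has_partials_fx = has_partials_smooth[OF smooth1(1)]

lemma has_partials_fy: "z \<in> S \<Longrightarrow> has_partials fy (fxy z) (fyy z) z"
  using has_partials_smooth[OF smooth1(2)] fyx by simp

lemma f_perp: "z \<in> S \<Longrightarrow> f z \<bullet> fx z = 0" "z \<in> S \<Longrightarrow> f z \<bullet> fy z = 0"
  using has_partials_inner_const[OF S _ norm_f has_partials_f has_partials_f]
  by (force simp: inner_commute)+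

lemma norm_f': "z \<in> S \<Longrightarrow> norm (f z) = 1"
  using norm_f by (simp add: norm_eq_1)

lemma fx_nz: "z \<in> S \<Longrightarrow> fx z \<noteq> 0"
  using alpha_nz norm_alpha[of f z] norm_f' f_perp by fastforce

text \<open>Adaptedness says that the squared lengths of \<open>fy\<close> and \<open>fx\<close>
  differ by 4, so the value that fits the length of \<open>fx\<close> also fits that of
  \<open>fy\<close>. The closed formula is what makes \<open>phi\<close> differentiable.\<close>

lemma phi_eq: "z \<in> S \<Longrightarrow> p z = arsinh (norm (fx z) / 2)"
proof (rule phi_eqI)
  assume z: "z \<in> S"
  let ?t = "arsinh (norm (fx z) / 2)"
  show "0 \<le> ?t" using arsinh_less_iff_real[of "norm (fx z) / 2" 0]
    by (metis arsinh_0 norm_ge_zero divide_nonneg_nonneg linorder_not_le zero_le_numeral)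
  have "(2 * cosh ?t)\<^sup>2 = (norm (fy z))\<^sup>2"
    using adapted'(1)[OF z] by (simp add: power_mult_distrib cosh_square_eq power_divide power2_norm_eq_inner)
  then show "norm (fy z) = 2 * cosh ?t"
    by (metis cosh_real_nonneg mult_nonneg_nonneg norm_ge_zero power2_eq_iff_nonneg zero_le_numeral)
qed (simp_all add: norm_f' f_perp)

lemma s_pos: "z \<in> S \<Longrightarrow> 0 < s z" using fx_nz by (simp add: phi_eq)

lemma c_pos: "0 < c z" by simp

lemma c_sq: "(c z)\<^sup>2 = (s z)\<^sup>2 + 1" by (rule cosh_square_eq)

lemma fx_fx: "z \<in> S \<Longrightarrow> fx z \<bullet> fx z = 4 * (s z)\<^sup>2"
  by (simp add: phi_eq power_divide power2_norm_eq_inner)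

lemma fy_fy: "z \<in> S \<Longrightarrow> fy z \<bullet> fy z = 4 * (c z)\<^sup>2"
  using fx_fx adapted'(1) c_sq[of z] by fastforce

lemma fx_e1: "z \<in> S \<Longrightarrow> fx z = (2 * s z) *\<^sub>R e1 z"
  using s_pos[of z] by (simp add: e1_def)

lemma fy_e2: "fy z = (2 * c z) *\<^sub>R e2 z"
  by (simp add: e2_def)

lemma frame: assumes z: "z \<in> S" shows "orthonormal4 (f z) (e1 z) (e2 z) (nv z)"
  unfolding nv_def using s_pos[OF z]
  by (intro orthonormal4_cross4)
    (simp_all add: z e1_def e2_def norm_f fx_fx fy_fy f_perp adapted'(2) power2_eq_square)

lemma frame_inner:
  assumes "z \<in> S"
  shows "f z \<bullet> f z = 1" "e1 z \<bullet> e1 z = 1" "e2 z \<bullet> e2 z = 1" "nv z \<bullet> nv z = 1"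
    "f z \<bullet> e1 z = 0" "f z \<bullet> e2 z = 0" "f z \<bullet> nv z = 0" "e1 z \<bullet> e2 z = 0" "e1 z \<bullet> nv z = 0" "e2 z \<bullet> nv z = 0"
    "e1 z \<bullet> f z = 0" "e2 z \<bullet> f z = 0" "nv z \<bullet> f z = 0" "e2 z \<bullet> e1 z = 0" "nv z \<bullet> e1 z = 0" "nv z \<bullet> e2 z = 0"
  using frame[OF assms] by (simp_all add: orthonormal4_def inner_commute)

lemma nrm_eq: "z \<in> S \<Longrightarrow> nrm f z = nv z"
  using s_pos[of z]
  unfolding nrm_def sinh_double
  by (simp add: qmult_cross3_alpha_beta norm_f' f_perp nv_def cross4_linear e1_def e2_def field_simps)

text \<open>The function \<open>arsinh (sqrt t / 2)\<close> is differentiable at positive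
  \<open>t\<close>, and \<open>fx\<close> vanishes nowhere because \<open>alpha\<close> does
  not.\<close>

lemma phi_differentiable: assumes z: "z \<in> S" shows "p differentiable (at z)"
proof -
  have "has_partials (\<lambda>w. fx w \<bullet> fx w) (2 * (fxx z \<bullet> fx z)) (2 * (fxy z \<bullet> fx z)) z"
    using has_partials_inner[OF has_partials_fx[OF z] has_partials_fx[OF z]] by (simp add: inner_commute)
  moreover have "((\<lambda>t. arsinh (sqrt t / 2)) has_field_derivative
      (1 / sqrt ((sqrt (fx z \<bullet> fx z) / 2)\<^sup>2 + 1)) * (inverse (sqrt (fx z \<bullet> fx z)) / 2 / 2)) (at (fx z \<bullet> fx z))"
    by (rule DERIV_chain2[OF arsinh_real_has_field_derivative DERIV_cdivide[OF DERIV_real_sqrt]])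
      (use fx_nz[OF z] in simp)
  ultimately obtain a b where "has_partials (\<lambda>w. arsinh (sqrt (fx w \<bullet> fx w) / 2)) a b z"
    using has_partials_chain[of "\<lambda>t. arsinh (sqrt t / 2)" _ "\<lambda>w. fx w \<bullet> fx w"] by blast
  from has_partials_cong[OF this S z, of p] show ?thesis
    using has_partials_differentiable by (simp add: phi_eq norm_eq_sqrt_inner)
qed

lemmas has_partials_p = differentiable_has_partials[OF phi_differentiable]

lemma has_partials_s: "z \<in> S \<Longrightarrow> has_partials s (c z * px z) (c z * py z) z"
  by (rule has_partials_chain[OF _ has_partials_p]) (auto intro!: derivative_eq_intros)

lemma has_partials_c: "z \<in> S \<Longrightarrow> has_partials c (s z * px z) (s z * py z) z"
  by (rule has_partials_chain[OF _ has_partials_p]) (auto intro!: derivative_eq_intros)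

section \<open>Structure equations: derivatives of the frame\<close>

text \<open>Each value comes from differentiating a first-order relation: orthogonality to
  \<open>f\<close>, orthogonality of \<open>fx\<close> and \<open>fy\<close>, or their lengths in
  terms of \<open>s\<close> and \<open>c\<close>.\<close>

lemma second_derivative_inner:
  assumes z: "z \<in> S"
  shows "fxx z \<bullet> f z = - 4 * (s z)\<^sup>2" "fxy z \<bullet> f z = 0" "fyy z \<bullet> f z = - 4 * (c z)\<^sup>2"
    "fxx z \<bullet> fx z = 4 * s z * c z * px z" "fxy z \<bullet> fx z = 4 * s z * c z * py z"
    "fxy z \<bullet> fy z = 4 * s z * c z * px z" "fyy z \<bullet> fy z = 4 * s z * c z * py z"
    "fxx z \<bullet> fy z = - 4 * s z * c z * py z" "fyy z \<bullet> fx z = - 4 * s z * c z * px z"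
proof -
  note D = has_partials_f[OF z] has_partials_fx[OF z] has_partials_fy[OF z]
  show "fxx z \<bullet> f z = - 4 * (s z)\<^sup>2" "fxy z \<bullet> f z = 0"
    using has_partials_inner_const[OF S z f_perp(1) D(1,2)] adapted'(2)[OF z] fx_fx[OF z]
    by (simp_all add: inner_commute)
  show "fyy z \<bullet> f z = - 4 * (c z)\<^sup>2"
    using has_partials_inner_const[OF S z f_perp(2) D(1,3)] fy_fy[OF z]
    by (simp add: inner_commute)
  have s2: "has_partials (\<lambda>w. 4 * (s w * s w)) (4 * (c z * px z * s z + s z * (c z * px z)))
      (4 * (c z * py z * s z + s z * (c z * py z))) z"
    by (intro has_partials_cmult has_partials_mult has_partials_s z)
  have "has_partials (\<lambda>w. fx w \<bullet> fx w) (4 * (c z * px z * s z + s z * (c z * px z)))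
      (4 * (c z * py z * s z + s z * (c z * py z))) z"
    by (rule has_partials_cong[OF s2 S z]) (simp add: fx_fx power2_eq_square)
  from has_partials_unique[OF has_partials_inner[OF D(2,2)] this]
  show 1: "fxx z \<bullet> fx z = 4 * s z * c z * px z" "fxy z \<bullet> fx z = 4 * s z * c z * py z"
    by (simp_all add: inner_commute)
  have c2: "has_partials (\<lambda>w. 4 * (c w * c w)) (4 * (s z * px z * c z + c z * (s z * px z)))
      (4 * (s z * py z * c z + c z * (s z * py z))) z"
    by (intro has_partials_cmult has_partials_mult has_partials_c z)
  have "has_partials (\<lambda>w. fy w \<bullet> fy w) (4 * (s z * px z * c z + c z * (s z * px z)))
      (4 * (s z * py z * c z + c z * (s z * py z))) z"
    by (rule has_partials_cong[OF c2 S z]) (simp add: fy_fy power2_eq_square)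
  from has_partials_unique[OF has_partials_inner[OF D(3,3)] this]
  show 2: "fxy z \<bullet> fy z = 4 * s z * c z * px z" "fyy z \<bullet> fy z = 4 * s z * c z * py z"
    by (simp_all add: inner_commute)
  show "fxx z \<bullet> fy z = - 4 * s z * c z * py z" "fyy z \<bullet> fx z = - 4 * s z * c z * px z"
    using has_partials_inner_const[OF S z adapted'(2) D(2,3)] 1 2 by (simp_all add: inner_commute)
qed

text \<open>The Laplacian of a harmonic map into the sphere is a multiple of \<open>f\<close>, so
  the second fundamental form is trace-free in these coordinates.\<close>

lemma fyy_nv: assumes z: "z \<in> S" shows "fyy z \<bullet> nv z = - h11 z"
proof -
  have "(fxx z + fyy z) \<bullet> nv z = 0" by (simp only: laplace[OF z]) (simp add: frame_inner z)
  then show ?thesis by (simp add: h11_def inner_add_left)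
qed

lemma second_derivatives:
  assumes z: "z \<in> S"
  shows "fxx z = (- 4 * (s z)\<^sup>2) *\<^sub>R f z + (2 * c z * px z) *\<^sub>R e1 z - (2 * s z * py z) *\<^sub>R e2 z + h11 z *\<^sub>R nv z"
    and "fxy z = (2 * c z * py z) *\<^sub>R e1 z + (2 * s z * px z) *\<^sub>R e2 z + h12 z *\<^sub>R nv z"
    and "fyy z = (- 4 * (c z)\<^sup>2) *\<^sub>R f z - (2 * c z * px z) *\<^sub>R e1 z
      + (2 * s z * py z) *\<^sub>R e2 z - h11 z *\<^sub>R nv z"
proof -
  have e: "v \<bullet> e1 z = (v \<bullet> fx z) / (2 * s z)" "v \<bullet> e2 z = (v \<bullet> fy z) / (2 * c z)" for v
    by (simp_all add: e1_def e2_def)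
  note i = second_derivative_inner[OF z] frame_inner[OF z] fyy_nv[OF z] h11_def[symmetric] h12_def[symmetric]
    inner_add_left inner_diff_left
  have nz: "s z \<noteq> 0" "c z \<noteq> 0" using s_pos[OF z] by auto
  show "fxx z = (- 4 * (s z)\<^sup>2) *\<^sub>R f z + (2 * c z * px z) *\<^sub>R e1 z - (2 * s z * py z) *\<^sub>R e2 z + h11 z *\<^sub>R nv z"
    by (rule orthonormal4_eqI[OF frame[OF z]]) (use nz in \<open>simp_all add: i e(1)[of "fxx z"] e(2)[of "fxx z"]\<close>)
  show "fxy z = (2 * c z * py z) *\<^sub>R e1 z + (2 * s z * px z) *\<^sub>R e2 z + h12 z *\<^sub>R nv z"
    by (rule orthonormal4_eqI[OF frame[OF z]]) (use nz in \<open>simp_all add: i e(1)[of "fxy z"] e(2)[of "fxy z"]\<close>)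
  show "fyy z = (- 4 * (c z)\<^sup>2) *\<^sub>R f z - (2 * c z * px z) *\<^sub>R e1 z
    + (2 * s z * py z) *\<^sub>R e2 z - h11 z *\<^sub>R nv z"
    by (rule orthonormal4_eqI[OF frame[OF z]]) (use nz in \<open>simp_all add: i e(1)[of "fyy z"] e(2)[of "fyy z"]\<close>)
qed

lemma has_partials_e1:
  assumes z: "z \<in> S"
  shows "has_partials e1 ((- 2 * s z) *\<^sub>R f z - py z *\<^sub>R e2 z + (h11 z / (2 * s z)) *\<^sub>R nv z)
    (px z *\<^sub>R e2 z + (h12 z / (2 * s z)) *\<^sub>R nv z) z"
proof -
  have nz: "s z \<noteq> 0" using s_pos[OF z] by simp
  have "((\<lambda>t. 1 / (2 * t)) has_field_derivative - 1 / (2 * (s z)\<^sup>2)) (at (s z))"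
    using nz by (auto intro!: derivative_eq_intros simp: power2_eq_square field_simps)
  \<comment> \<open>The quotient rule serves for existence only; the values are then found by
    differentiating \<open>fx = (2 * s) *\<^sub>R e1\<close> and solving.\<close>
  from has_partials_scaleR[OF has_partials_chain[OF this has_partials_s[OF z]] has_partials_fx[OF z]]
  obtain a b where ab: "has_partials e1 a b z" unfolding e1_def by blast
  have "has_partials fx ((2 * (c z * px z)) *\<^sub>R e1 z + (2 * s z) *\<^sub>R a)
      ((2 * (c z * py z)) *\<^sub>R e1 z + (2 * s z) *\<^sub>R b) z"
    by (rule has_partials_cong[OF has_partials_scaleR[OF has_partials_cmult[OF has_partials_s[OF z], of 2] ab] S z])
      (simp add: fx_e1)
  note u = has_partials_unique[OF this has_partials_fx[OF z]]
  have "(2 * s z) *\<^sub>R a = fxx z - (2 * (c z * px z)) *\<^sub>R e1 z"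
    "(2 * s z) *\<^sub>R b = fxy z - (2 * (c z * py z)) *\<^sub>R e1 z"
    using u by (simp_all add: algebra_simps)
  note ab' = vector_divide_solve[OF _ this(1)] vector_divide_solve[OF _ this(2)]
  have "a = (- 2 * s z) *\<^sub>R f z - py z *\<^sub>R e2 z + (h11 z / (2 * s z)) *\<^sub>R nv z"
    "b = px z *\<^sub>R e2 z + (h12 z / (2 * s z)) *\<^sub>R nv z"
    using nz by (simp_all add: ab' second_derivatives[OF z] algebra_simps power2_eq_square)
  then show ?thesis using ab by simp
qed

lemma has_partials_e2:
  assumes z: "z \<in> S"
  shows "has_partials e2 (py z *\<^sub>R e1 z + (h12 z / (2 * c z)) *\<^sub>R nv z)
    ((- 2 * c z) *\<^sub>R f z - px z *\<^sub>R e1 z - (h11 z / (2 * c z)) *\<^sub>R nv z) z"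
proof -
  have nz: "c z \<noteq> 0" by simp
  have "((\<lambda>t. 1 / (2 * t)) has_field_derivative - 1 / (2 * (c z)\<^sup>2)) (at (c z))"
    using nz by (auto intro!: derivative_eq_intros simp: power2_eq_square field_simps)
  from has_partials_scaleR[OF has_partials_chain[OF this has_partials_c[OF z]] has_partials_fy[OF z]]
  obtain a b where ab: "has_partials e2 a b z" unfolding e2_def by blast
  have "has_partials fy ((2 * (s z * px z)) *\<^sub>R e2 z + (2 * c z) *\<^sub>R a)
      ((2 * (s z * py z)) *\<^sub>R e2 z + (2 * c z) *\<^sub>R b) z"
    by (rule has_partials_cong[OF has_partials_scaleR[OF has_partials_cmult[OF has_partials_c[OF z], of 2] ab] S z])
      (simp add: fy_e2)
  note u = has_partials_unique[OF this has_partials_fy[OF z]]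
  have "(2 * c z) *\<^sub>R a = fxy z - (2 * (s z * px z)) *\<^sub>R e2 z"
    "(2 * c z) *\<^sub>R b = fyy z - (2 * (s z * py z)) *\<^sub>R e2 z"
    using u by (simp_all add: algebra_simps)
  note ab' = vector_divide_solve[OF _ this(1)] vector_divide_solve[OF _ this(2)]
  have "a = py z *\<^sub>R e1 z + (h12 z / (2 * c z)) *\<^sub>R nv z"
    "b = (- 2 * c z) *\<^sub>R f z - px z *\<^sub>R e1 z - (h11 z / (2 * c z)) *\<^sub>R nv z"
    using nz by (simp_all add: ab' second_derivatives[OF z] algebra_simps power2_eq_square)
  then show ?thesis using ab by simp
qed

text \<open>The Weingarten equations. Existence follows from the polynomial formula for
  \<open>cross4\<close>; by orthonormality the coefficients are minus the \<open>nv\<close>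
  coefficients of the derivatives of \<open>f\<close>, \<open>e1\<close> and
  \<open>e2\<close>.\<close>

lemma has_partials_nv:
  assumes z: "z \<in> S"
  shows "has_partials nv (- (h11 z / (2 * s z)) *\<^sub>R e1 z - (h12 z / (2 * c z)) *\<^sub>R e2 z)
    (- (h12 z / (2 * s z)) *\<^sub>R e1 z + (h11 z / (2 * c z)) *\<^sub>R e2 z) z"
proof -
  have "nv differentiable (at z)"
    unfolding nv_def
    by (intro differentiable_cross4 has_partials_differentiable[OF has_partials_f[OF z]]
        has_partials_differentiable[OF has_partials_e1[OF z]] has_partials_differentiable[OF has_partials_e2[OF z]])
  from differentiable_has_partials[OF this] obtain a b where n: "has_partials nv a b z" by blast
  have 0: "a \<bullet> nv z = 0" "b \<bullet> nv z = 0"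
    using has_partials_inner_const[OF S z frame_inner(4) n n] by (simp_all add: inner_commute)
  have 1: "a \<bullet> f z = 0" "b \<bullet> f z = 0"
    using has_partials_inner_const[OF S z frame_inner(13) n has_partials_f[OF z]]
    by (simp_all add: fx_e1[OF z] fy_e2 frame_inner[OF z])
  have 2: "a \<bullet> e1 z = - (h11 z / (2 * s z))" "b \<bullet> e1 z = - (h12 z / (2 * s z))"
    using has_partials_inner_const[OF S z frame_inner(15) n has_partials_e1[OF z]]
    by (simp_all add: frame_inner[OF z] inner_add_right inner_diff_right)
  have 3: "a \<bullet> e2 z = - (h12 z / (2 * c z))" "b \<bullet> e2 z = h11 z / (2 * c z)"
    using has_partials_inner_const[OF S z frame_inner(16) n has_partials_e2[OF z]]
    by (simp_all add: frame_inner[OF z] inner_add_right inner_diff_right)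
  have "a = - (h11 z / (2 * s z)) *\<^sub>R e1 z - (h12 z / (2 * c z)) *\<^sub>R e2 z"
    "b = - (h12 z / (2 * s z)) *\<^sub>R e1 z + (h11 z / (2 * c z)) *\<^sub>R e2 z"
    using orthonormal4_expand[OF frame[OF z], of a] orthonormal4_expand[OF frame[OF z], of b]
    by (simp_all add: 0 1 2 3)
  then show ?thesis using n by simp
qed

section \<open>Symmetry of third derivatives: the Codazzi and Gauss equations\<close>

lemmas has_partials_fxx = has_partials_smooth[OF smooth2(1)]
lemmas has_partials_fxy = has_partials_smooth[OF smooth2(2)]
lemmas has_partials_fyy = has_partials_smooth[OF smooth2(4)]

lemma third_derivatives:
  assumes z: "z \<in> S" shows "dy fxx z = dx fxy z" "dx fyy z = dy fxy z"
  using partials_commute[OF S z has_partials_fx has_partials_fxx[OF z] has_partials_fxy[OF z]]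
    partials_commute[OF S z has_partials_fy has_partials_fxy[OF z] has_partials_fyy[OF z]] by simp_all

lemma has_partials_h11: "z \<in> S \<Longrightarrow> has_partials h11 (dx h11 z) (dy h11 z) z"
  and has_partials_h12: "z \<in> S \<Longrightarrow> has_partials h12 (dx h12 z) (dy h12 z) z"
  using has_partials_inner[OF has_partials_fxx has_partials_nv]
    has_partials_inner[OF has_partials_fxy has_partials_nv]
  by (auto simp: h11_def[abs_def] h12_def[abs_def]
      intro!: differentiable_has_partials has_partials_differentiable)

text \<open>The normal component of the symmetry of third derivatives: these cancel and leave second
  derivatives paired with derivatives of \<open>nv\<close>.\<close>

lemma codazzi:
  assumes z: "z \<in> S"
  shows "dx h11 z + dy h12 z = - (h11 z * px z + h12 z * py z) / (s z * c z)"
    and "dy h11 z - dx h12 z = - (h12 z * px z - h11 z * py z) / (s z * c z)"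
proof -
  note n = has_partials_nv[OF z]
  have nz: "s z \<noteq> 0" "c z \<noteq> 0" using s_pos[OF z] by auto
  note h11 = has_partials_inner[OF has_partials_fxx[OF z] n, folded h11_def[abs_def]]
  note h12 = has_partials_inner[OF has_partials_fxy[OF z] n, folded h12_def[abs_def]]
  \<comment> \<open>Since \<open>fyy \<bullet> nv\<close> is \<open>- h11\<close>, the derivative of
    \<open>h11\<close> in the direction of x can also be computed from \<open>fyy\<close>.\<close>
  note h22 = has_partials_cong[OF has_partials_inner[OF has_partials_fyy[OF z] n] S z fyy_nv]
  note u = has_partials_unique[OF h22 has_partials_minus[OF has_partials_h11[OF z]]]
    has_partials_unique[OF h11 has_partials_h11[OF z]] has_partials_unique[OF h12 has_partials_h12[OF z]]
  note i = second_derivatives[OF z] frame_inner[OF z] inner_add_left inner_diff_left inner_add_right inner_diff_right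
  have "dx h11 z + dy h12 z = fxy z \<bullet> (- (h12 z / (2 * s z)) *\<^sub>R e1 z
    + (h11 z / (2 * c z)) *\<^sub>R e2 z)
      - fyy z \<bullet> (- (h11 z / (2 * s z)) *\<^sub>R e1 z - (h12 z / (2 * c z)) *\<^sub>R e2 z)"
    using u(1,6) third_derivatives[OF z] by simp
  also have "\<dots> = - (h11 z * px z + h12 z * py z) * ((c z)\<^sup>2 - (s z)\<^sup>2) / (s z * c z)"
    using nz by (simp add: i field_simps power2_eq_square)
  finally show "dx h11 z + dy h12 z = - (h11 z * px z + h12 z * py z) / (s z * c z)"
    by (simp add: c_sq)
  have "dy h11 z - dx h12 z = fxx z \<bullet> (- (h12 z / (2 * s z)) *\<^sub>R e1 z
    + (h11 z / (2 * c z)) *\<^sub>R e2 z)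
      - fxy z \<bullet> (- (h11 z / (2 * s z)) *\<^sub>R e1 z - (h12 z / (2 * c z)) *\<^sub>R e2 z)"
    using u(4,5) third_derivatives[OF z] by simp
  also have "\<dots> = - (h12 z * px z - h11 z * py z) * ((c z)\<^sup>2 - (s z)\<^sup>2) / (s z * c z)"
    using nz by (simp add: i field_simps power2_eq_square)
  finally show "dy h11 z - dx h12 z = - (h12 z * px z - h11 z * py z) / (s z * c z)"
    by (simp add: c_sq)
qed

text \<open>The \<open>e2\<close> component of the symmetry of third derivatives. For critical
  \<open>p\<close> both \<open>fxx\<close> and \<open>fxy\<close> are orthogonal to
  \<open>e2\<close>, so differentiating these relations moves the third derivatives onto the
  derivatives of \<open>e2\<close>.\<close>

lemma gauss_constant_phi:
  assumes 0: "\<And>w. w \<in> S \<Longrightarrow> px w = 0" "\<And>w. w \<in> S \<Longrightarrow> py w = 0"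
    and z: "z \<in> S"
  shows "(h11 z)\<^sup>2 + (h12 z)\<^sup>2 = 16 * (s z)\<^sup>2 * (c z)\<^sup>2"
proof -
  have nz: "s z \<noteq> 0" "c z \<noteq> 0" using s_pos[OF z] by auto
  note i = second_derivatives frame_inner inner_add_left inner_diff_left inner_add_right inner_diff_right
  have k: "fxx w \<bullet> e2 w = 0" "fxy w \<bullet> e2 w = 0" if "w \<in> S" for w
    using that by (simp_all add: i 0)
  note e = has_partials_inner_const(2)[OF S z k(1) has_partials_fxx[OF z] has_partials_e2[OF z]]
     has_partials_inner_const(1)[OF S z k(2) has_partials_fxy[OF z] has_partials_e2[OF z]]
  have "fxx z \<bullet> ((- 2 * c z) *\<^sub>R f z - px z *\<^sub>R e1 z - (h11 z / (2 * c z)) *\<^sub>R nv z) =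
      fxy z \<bullet> (py z *\<^sub>R e1 z + (h12 z / (2 * c z)) *\<^sub>R nv z)"
    using e third_derivatives(1)[OF z] by simp
  then have "8 * (s z)\<^sup>2 * c z - h11 z * (h11 z / (2 * c z)) = h12 z * (h12 z / (2 * c z))"
    using z by (simp add: i 0 mult_ac)
  then show ?thesis using nz by (simp add: field_simps power2_eq_square)
qed

text \<open>The partials of \<open>p\<close> are, up to the factor \<open>2 * c\<close>, frame
  coefficients of second derivatives of \<open>f\<close>, hence differentiable. The
  differentiability of \<open>gx\<close> and \<open>gy\<close> rests on this.\<close>

lemma has_partials_px: "z \<in> S \<Longrightarrow> has_partials px (dx px z) (dy px z) z"
  and has_partials_py: "z \<in> S \<Longrightarrow> has_partials py (dx py z) (dy py z) z"
proof -
  assume z: "z \<in> S"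
  have "((\<lambda>t. 1 / (2 * t)) has_field_derivative - 1 / (2 * (c z)\<^sup>2)) (at (c z))"
    by (auto intro!: derivative_eq_intros simp: power2_eq_square field_simps)
  note r = has_partials_chain[OF this has_partials_c[OF z]]
  have 1: "1 / (2 * c w) * (fxx w \<bullet> e1 w) = px w" "1 / (2 * c w) * (fxy w \<bullet> e1 w) = py w" if "w \<in> S" for w
    using that by (simp_all add: second_derivatives inner_add_left inner_diff_left frame_inner)
  show "has_partials px (dx px z) (dy px z) z" "has_partials py (dx py z) (dy py z) z"
    using has_partials_cong[OF has_partials_mult[OF r has_partials_inner[OF has_partials_fxx[OF z]
      has_partials_e1[OF z]]] S z 1(1)]
      has_partials_cong[OF has_partials_mult[OF r has_partials_inner[OF has_partials_fxy[OF z]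
      has_partials_e1[OF z]]] S z 1(2)]
    by (auto intro!: differentiable_has_partials has_partials_differentiable)
qed

text \<open>Four times the second complex derivative is \<open>fxx - fyy - 2 i fxy\<close>, with
  normal component \<open>2 h11 - 2 i h12\<close>.\<close>

lemma mu_eq: "z \<in> S \<Longrightarrow> mu f z = Complex (h11 z / 2) (- h12 z / 2)"
proof -
  assume z: "z \<in> S"
  have "del (del (\<lambda>w. cvec (f w))) z =
      (1/4) *s (cvec (fxx z - fyy z) - \<i> *s cvec (dx fy z + fxy z))"
    by (rule del_del_cvec[OF S z])
      (use z has_partials_f has_partials_fx has_partials_fy has_partials_differentiable in blast)+
  then have "mu f z = (1/4) * (of_real (fxx z \<bullet> nv z - fyy z \<bullet> nv z) - \<i> * of_real (dx fy z \<bullet> nv z + fxy z \<bullet> nv z))"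
    by (simp only: mu_def nrm_eq[OF z] cdot_linear cdot_cvec inner_diff_left inner_add_left)
  then show ?thesis
    by (simp add: z fyx fyy_nv h11_def[symmetric] h12_def[symmetric] complex_eq_iff)
qed

end

section \<open>The transform\<close>

locale adapted_transform = adapted_harmonic +
  fixes eps :: real
  assumes eps: "eps * eps = 1"
begin

abbreviation "g \<equiv> transform eps f"

text \<open>Real and imaginary parts, up to sign, of the quantity that governs the transform: twice
  the complex derivative of \<open>p\<close> plus \<open>eps * i * mu\<close> equals
  \<open>eps * (Q - i P)\<close>.\<close>

definition "P z = eps * py z - h11 z / 2"
definition "Q z = eps * px z + h12 z / 2"
text \<open>The transform lies in the plane of \<open>e2\<close> and \<open>nv\<close>;
  \<open>V\<close> is orthogonal to it there, so that \<open>f\<close>, \<open>e1\<close>,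
  \<open>V\<close>, \<open>g\<close> is another orthonormal frame.\<close>

definition "V z = - (s z / c z) *\<^sub>R e2 z + (eps / c z) *\<^sub>R nv z"
text \<open>The partials of the transform. Apart from the \<open>f\<close> term, \<open>gy\<close>
  is \<open>gx\<close> turned by a right angle in the plane of \<open>e1\<close> and
  \<open>V\<close>, which makes adaptedness visible.\<close>

definition "gx z = (P z / c z) *\<^sub>R e1 z + (Q z / c z) *\<^sub>R V z"
definition "gy z = (- 2 * eps) *\<^sub>R f z - (Q z / c z) *\<^sub>R e1 z + (P z / c z) *\<^sub>R V z"

lemma transform_eq: "z \<in> S \<Longrightarrow> g z = (eps / c z) *\<^sub>R e2 z + (s z / c z) *\<^sub>R nv z"
  by (simp add: transform_def qmult_imq_add qmult_imq_scaleR qmult_cross3_alpha_beta qmult_beta norm_f' frame_inner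
      fx_e1 fy_e2 cross4_linear nv_def[symmetric] scaleR_add_right power2_eq_square field_simps)

lemma has_partials_g: assumes z: "z \<in> S" shows "has_partials g (gx z) (gy z) z"
proof -
  have cs: "c z * c z = s z * s z + 1" using c_sq[of z] by (simp add: power2_eq_square)
  have nz: "s z \<noteq> 0" "c z \<noteq> 0" using s_pos[OF z] by auto
  have E: "((\<lambda>t. eps / t) has_field_derivative - eps / (c z)\<^sup>2) (at (c z))"
    "((\<lambda>t. 1 / t) has_field_derivative - 1 / (c z)\<^sup>2) (at (c z))"
    by (auto intro!: derivative_eq_intros simp: power2_eq_square field_simps)
  note r = has_partials_chain[OF E(1) has_partials_c[OF z]] has_partials_chain[OF E(2) has_partials_c[OF z]]
  note D = has_partials_add[OF has_partials_scaleR[OF r(1) has_partials_e2[OF z]]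
      has_partials_scaleR[OF has_partials_mult[OF has_partials_s[OF z] r(2)] has_partials_nv[OF z]]]
  have e: "eps * (eps * x) = x" for x using eps by (simp flip: mult.assoc)
  note i = frame_inner[OF z] inner_add_left inner_diff_left gx_def gy_def V_def P_def Q_def
  \<comment> \<open>The right-hand side is what the product rule returns; agreement is checked
    coefficientwise with \<open>cs\<close> and \<open>e\<close>.\<close>
  have x: "gx z = (- eps / (c z)\<^sup>2 * (s z * px z)) *\<^sub>R e2 z
    + (eps / c z) *\<^sub>R (py z *\<^sub>R e1 z + (h12 z / (2 * c z)) *\<^sub>R nv z) +
   ((c z * px z * (1 / c z) + s z * (- 1 / (c z)\<^sup>2 * (s z * px z))) *\<^sub>R nv z +
     (s z * (1 / c z)) *\<^sub>R (- (h11 z / (2 * s z)) *\<^sub>R e1 z - (h12 z / (2 * c z)) *\<^sub>R e2 z))"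
    by (rule orthonormal4_eqI[OF frame[OF z]], use nz in \<open>simp_all add: i\<close>,
        simp_all add: field_simps power2_eq_square, simp_all add: cs e algebra_simps)
  have y: "gy z = (- eps / (c z)\<^sup>2 * (s z * py z)) *\<^sub>R e2 z
    + (eps / c z) *\<^sub>R ((- 2 * c z) *\<^sub>R f z - px z *\<^sub>R e1 z - (h11 z / (2 * c z)) *\<^sub>R nv z) +
   ((c z * py z * (1 / c z) + s z * (- 1 / (c z)\<^sup>2 * (s z * py z))) *\<^sub>R nv z +
     (s z * (1 / c z)) *\<^sub>R (- (h12 z / (2 * s z)) *\<^sub>R e1 z + (h11 z / (2 * c z)) *\<^sub>R e2 z))"
    by (rule orthonormal4_eqI[OF frame[OF z]], use nz in \<open>simp_all add: i\<close>,
        simp_all add: field_simps power2_eq_square, simp_all add: cs e algebra_simps)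
  show ?thesis
    unfolding x y by (rule has_partials_cong[OF D S z]) (simp add: transform_eq)
qed

text \<open>Candidate for the unit normal of \<open>g\<close>: the vector of \<open>cross4_g\<close>
  divided by \<open>4 * s * c\<close>. As a combination of \<open>gy\<close> and \<open>f\<close> it
  is easily paired with the second derivatives of \<open>g\<close>.\<close>

definition "nu z = (eps / (2 * s z * c z)) *\<^sub>R gy z + (c z / s z) *\<^sub>R f z"

lemma eps_sq: "eps\<^sup>2 = 1"
  using eps by (simp add: power2_eq_square)

lemma frame_V: assumes z: "z \<in> S"
  shows "V z \<bullet> V z = 1" "V z \<bullet> e1 z = 0" "e1 z \<bullet> V z = 0" "V z \<bullet> f z = 0" "f z \<bullet> V z = 0"
    "V z \<bullet> e2 z = - (s z / c z)" "e2 z \<bullet> V z = - (s z / c z)" "V z \<bullet> g z = 0" "g z \<bullet> V z = 0"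
    "g z \<bullet> g z = 1" "g z \<bullet> e1 z = 0" "e1 z \<bullet> g z = 0" "f z \<bullet> g z = 0" "g z \<bullet> f z = 0"
proof -
  have nz: "c z \<noteq> 0" by simp
  note i = V_def transform_eq[OF z] frame_inner[OF z] inner_add_left inner_add_right
    inner_diff_left inner_diff_right
  have "eps * eps + s z * s z = c z * c z"
    using c_sq[of z] by (simp add: eps power2_eq_square)
  then have "(eps * eps + s z * s z) / (c z * c z) = 1"
    using nz by simp
  then have 1: "eps * eps / (c z * c z) + s z * s z / (c z * c z) = 1"
    by (simp add: add_divide_distrib)
  show "V z \<bullet> V z = 1" "g z \<bullet> g z = 1" using 1 by (simp_all add: i)
  show "V z \<bullet> g z = 0" "g z \<bullet> V z = 0" by (simp_all add: i)
qed (simp_all add: V_def transform_eq z frame_inner inner_add_left inner_add_right inner_diff_left inner_diff_right)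

lemma g_inner:
  assumes z: "z \<in> S"
  shows "gx z \<bullet> gx z = ((P z)\<^sup>2 + (Q z)\<^sup>2) / (c z)\<^sup>2" "gy z \<bullet> gy z = 4
    + ((P z)\<^sup>2 + (Q z)\<^sup>2) / (c z)\<^sup>2"
    "gx z \<bullet> gy z = 0" "g z \<bullet> gx z = 0" "g z \<bullet> gy z = 0"
    "gx z \<bullet> f z = 0" "gy z \<bullet> f z = - 2 * eps"
    "gx z \<bullet> fx z = 2 * s z * P z / c z" "gx z \<bullet> fy z = - 2 * s z * Q z / c z"
    "gy z \<bullet> fx z = - 2 * s z * Q z / c z" "gy z \<bullet> fy z = - 2 * s z * P z / c z"
  using eps_sq by (simp_all add: gx_def gy_def frame_V frame_inner z inner_add_left inner_add_right inner_diff_left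
      inner_diff_right fx_e1 fy_e2 power2_eq_square add_divide_distrib)

lemma dx_g: "z \<in> S \<Longrightarrow> dx g z = gx z" and dy_g: "z \<in> S \<Longrightarrow> dy g z = gy z"
  using has_partials_g has_partials_dx has_partials_dy by blast+

lemma norm_g: "z \<in> S \<Longrightarrow> norm (g z) = 1"
  using frame_V(10) by (simp add: norm_eq_1)

lemma phi_g: "z \<in> S \<Longrightarrow> phi g z = arsinh (norm (gx z) / 2)"
proof (rule phi_eqI)
  assume z: "z \<in> S"
  let ?t = "arsinh (norm (gx z) / 2)"
  show "0 \<le> ?t" using arsinh_less_iff_real[of "norm (gx z) / 2" 0]
    by (metis arsinh_0 norm_ge_zero divide_nonneg_nonneg linorder_not_le zero_le_numeral)
  have "(2 * cosh ?t)\<^sup>2 = 4 + gx z \<bullet> gx z"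
    by (simp add: power_mult_distrib cosh_square_eq power_divide power2_norm_eq_inner)
  also have "\<dots> = (norm (gy z))\<^sup>2"
    by (simp add: power2_norm_eq_inner g_inner z)
  finally have "(2 * cosh ?t)\<^sup>2 = (norm (gy z))\<^sup>2" .
  then show "norm (dy g z) = 2 * cosh ?t"
    by (metis dy_g[OF z] cosh_real_nonneg mult_nonneg_nonneg norm_ge_zero power2_eq_iff_nonneg zero_le_numeral)
qed (simp_all add: norm_g dx_g dy_g g_inner)

text \<open>Equality of the two functions amounts to \<open>gx\<close> having length
  \<open>2 * s\<close>, a polynomial condition once squared.\<close>

lemma phi_g_eq_iff:
  assumes z: "z \<in> S"
  shows "phi g z = p z \<longleftrightarrow> (P z)\<^sup>2 + (Q z)\<^sup>2 = 4 * (s z)\<^sup>2 * (c z)\<^sup>2"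
proof -
  have "phi g z = p z \<longleftrightarrow> norm (gx z) = 2 * s z"
    unfolding phi_g[OF z] by (metis arsinh_sinh_real sinh_arsinh_real nonzero_mult_div_cancel_left
        times_divide_eq_right zero_neq_numeral)
  also have "\<dots> \<longleftrightarrow> (norm (gx z))\<^sup>2 = (2 * s z)\<^sup>2"
    using s_pos[OF z] by (intro power2_eq_iff_nonneg[symmetric]) auto
  also have "\<dots> \<longleftrightarrow> (P z)\<^sup>2 + (Q z)\<^sup>2 = 4 * (s z)\<^sup>2 * (c z)\<^sup>2"
    by (simp add: power2_norm_eq_inner g_inner z power_mult_distrib divide_eq_eq)
  finally show ?thesis .
qed

text \<open>Existence is the point here: all ingredients, including \<open>px\<close>,
  \<open>py\<close>, \<open>h11\<close> and \<open>h12\<close>, are differentiable. Quotients are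
  rewritten as products with \<open>1 / c\<close> so that the rules compose.\<close>

lemma has_partials_gx: "z \<in> S \<Longrightarrow> has_partials gx (dx gx z) (dy gx z) z"
  and has_partials_gy: "z \<in> S \<Longrightarrow> has_partials gy (dx gy z) (dy gy z) z"
proof -
  assume z: "z \<in> S"
  have c: "((\<lambda>t. 1 / t) has_field_derivative - 1 / (c z)\<^sup>2) (at (c z))"
    by (auto intro!: derivative_eq_intros simp: power2_eq_square field_simps)
  note r = has_partials_chain[OF c has_partials_c[OF z]]
  note P = has_partials_diff[OF has_partials_cmult[OF has_partials_py[OF z], of eps] has_partials_cmult[OF
    has_partials_h11[OF z], of "1/2"]]
  note Q = has_partials_add[OF has_partials_cmult[OF has_partials_px[OF z], of eps] has_partials_cmult[OF
    has_partials_h12[OF z], of "1/2"]]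
  note e = has_partials_e1[OF z]
  note V = has_partials_add[OF has_partials_minus[OF has_partials_scaleR[OF has_partials_mult[OF
    has_partials_s[OF z] r] has_partials_e2[OF z]]]
      has_partials_scaleR[OF has_partials_cmult[OF r, of eps] has_partials_nv[OF z]]]
  have V': "V = (\<lambda>w. - ((s w * (1 / c w)) *\<^sub>R e2 w) + (eps * (1 / c w)) *\<^sub>R nv w)"
    by (rule ext) (simp add: V_def)
  note gx = has_partials_add[OF has_partials_scaleR[OF has_partials_mult[OF P r] e] has_partials_scaleR[OF
    has_partials_mult[OF Q r] V]]
  note gy = has_partials_add[OF has_partials_diff[OF has_partials_scaleR[OF has_partials_const[of "- 2 * eps"]
    has_partials_f[OF z]]
      has_partials_scaleR[OF has_partials_mult[OF Q r] e]] has_partials_scaleR[OF has_partials_mult[OF P r] V]]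
  have gx': "gx = (\<lambda>w. ((eps * py w - 1/2 * h11 w) * (1 / c w)) *\<^sub>R e1 w + ((eps * px w
    + 1/2 * h12 w) * (1 / c w)) *\<^sub>R (- ((s w * (1 / c w)) *\<^sub>R e2 w) + (eps * (1 / c w)) *\<^sub>R nv w))"
    by (rule ext) (simp add: gx_def V' P_def Q_def)
  have gy': "gy = (\<lambda>w. (- 2 * eps) *\<^sub>R f w - ((eps * px w
    + 1/2 * h12 w) * (1 / c w)) *\<^sub>R e1 w + ((eps * py w - 1/2 * h11 w) * (1 / c w)) *\<^sub>R (- ((s w * (1 / c w)) *\<^sub>R e2 w) + (eps * (1 / c w)) *\<^sub>R nv w))"
    by (rule ext) (simp add: gy_def V' P_def Q_def)
  show "has_partials gx (dx gx z) (dy gx z) z" "has_partials gy (dx gy z) (dy gy z) z"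
    unfolding gx' gy'
    by (rule differentiable_has_partials, rule has_partials_differentiable, rule gx)
      (rule differentiable_has_partials, rule has_partials_differentiable, rule gy)
qed

lemma gyx: "z \<in> S \<Longrightarrow> dx gy z = dy gx z"
  using partials_commute[OF S _ has_partials_g has_partials_gx has_partials_gy] by simp

text \<open>The product is computed in the frame \<open>g\<close>, \<open>e1\<close>,
  \<open>V\<close>, \<open>f\<close>, where \<open>gx\<close> and \<open>gy\<close> have few
  coefficients; the hypothesis enters only through the coefficient of \<open>f\<close>.\<close>

lemma cross4_g:
  assumes z: "z \<in> S" and PQ: "(P z)\<^sup>2 + (Q z)\<^sup>2 = 4 * (s z)\<^sup>2 * (c z)\<^sup>2"
  shows "cross4 (g z) (gx z) (gy z) = (2 * eps) *\<^sub>R gy z + (4 * (c z)\<^sup>2) *\<^sub>R f z"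
proof -
  \<comment> \<open>Sorting the arguments reduces every product of frame vectors to one of the known
    products.\<close>
  have perm: "cross4 y w x = cross4 x y w" "cross4 w x y = cross4 x y w" "cross4 y x w = - cross4 x y w"
    "cross4 x w y = - cross4 x y w" "cross4 w y x = - cross4 x y w" for x y w
    by (simp_all add: real4_simps cross4_def algebra_simps)
  note basic = nv_def[symmetric] cross4_orthonormal[OF frame[OF z] nv_def]
  note basic' = perm[where x = "f z" and y = "e1 z" and w = "e2 z", unfolded basic]
    perm[where x = "f z" and y = "e1 z" and w = "nv z", unfolded basic]
    perm[where x = "f z" and y = "e2 z" and w = "nv z", unfolded basic]
    perm[where x = "e1 z" and y = "e2 z" and w = "nv z", unfolded basic]
  have nz: "c z \<noteq> 0" by simp
  have cs: "c z * c z = s z * s z + 1" using c_sq[of z] by (simp add: power2_eq_square)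
  have e: "eps * (eps * x) = x" for x using eps by (simp flip: mult.assoc)
  have "eps * eps + s z * s z = c z * c z" by (simp add: eps cs)
  then have r: "(eps * eps + s z * s z) / (c z * c z) = 1" using nz by simp
  have V1: "cross4 (g z) (e1 z) (V z) = f z"
  proof -
    have "cross4 (g z) (e1 z) (V z) = ((eps * eps + s z * s z) / (c z * c z)) *\<^sub>R f z"
      unfolding transform_eq[OF z] V_def
      by (simp only: cross4_linear cross4_alternating(1-3) basic basic')
        (simp add: add_divide_distrib scaleR_add_left)
    then show ?thesis by (simp only: r scaleR_one)
  qed
  have V2: "cross4 (g z) (e1 z) (f z) = - V z"
    unfolding transform_eq[OF z] V_def
    by (simp only: cross4_linear cross4_alternating(1-3) basic basic') simp
  have V3: "cross4 (g z) (V z) (f z) = e1 z"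
  proof -
    have "cross4 (g z) (V z) (f z) = ((eps * eps + s z * s z) / (c z * c z)) *\<^sub>R e1 z"
      unfolding transform_eq[OF z] V_def
      by (simp only: cross4_linear cross4_alternating(1-3) basic basic')
        (simp add: add_divide_distrib scaleR_add_left)
    then show ?thesis by (simp only: r scaleR_one)
  qed
  have V4: "cross4 (g z) (V z) (e1 z) = - f z" using V1 perm(4)[of "g z" "V z" "e1 z"] by simp
  \<comment> \<open>To be used with \<open>a = P / c\<close>, \<open>b = Q / c\<close> and
    \<open>k = - 2 * eps\<close>.\<close>
  have combination: "cross4 (g z) (a *\<^sub>R e1 z + b *\<^sub>R V z) (k *\<^sub>R f z + (- b) *\<^sub>R e1 z
    + a *\<^sub>R V z) =
      (a * a + b * b) *\<^sub>R f z + (b * k) *\<^sub>R e1 z - (a * k) *\<^sub>R V z" for a b k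
    by (simp only: cross4_linear cross4_alternating(1-3) V1 V2 V3 V4) (simp add: algebra_simps)
  have gy: "gy z = (- 2 * eps) *\<^sub>R f z + (- (Q z / c z)) *\<^sub>R e1 z + (P z / c z) *\<^sub>R V z"
    by (simp add: gy_def)
  have "P z / c z * (P z / c z) + Q z / c z * (Q z / c z) = ((P z)\<^sup>2 + (Q z)\<^sup>2) / (c z)\<^sup>2"
    by (simp add: power2_eq_square add_divide_distrib)
  also have "\<dots> = 4 * (s z)\<^sup>2"
    unfolding PQ by (rule nonzero_mult_div_cancel_right) (use nz in simp)
  also have "\<dots> = 4 * (c z)\<^sup>2 - 4" by (simp add: c_sq)
  finally have "cross4 (g z) (gx z) (gy z) =
      (4 * (c z)\<^sup>2 - 4) *\<^sub>R f z + (Q z / c z * (- 2 * eps)) *\<^sub>R e1 z - (P z / c z * (- 2 * eps)) *\<^sub>R V z"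
    unfolding gy gx_def combination by (simp only:)
  also have "\<dots> = (2 * eps) *\<^sub>R gy z + (4 * (c z)\<^sup>2) *\<^sub>R f z"
    by (rule orthonormal4_eqI[OF frame[OF z]])
      (simp_all add: gy frame_V frame_inner z V_def inner_add_left inner_diff_left eps e algebra_simps)
  finally show ?thesis .
qed

end

text \<open>The assumption says that \<open>f\<close> and its transform have the same \<open>\<phi>\<close>.\<close>

locale adapted_transform_phi = adapted_transform +
  assumes PQ: "\<And>z. z \<in> S \<Longrightarrow> (P z)\<^sup>2 + (Q z)\<^sup>2 = 4 * (s z)\<^sup>2 * (c z)\<^sup>2"
begin

lemma phi_g_eq: "z \<in> S \<Longrightarrow> phi g z = p z"
  using PQ phi_g_eq_iff by blast

lemma nrm_g: "z \<in> S \<Longrightarrow> nrm g z = nu z"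
  unfolding nrm_def phi_g_eq sinh_double
  using s_pos[of z]
  by (simp add: qmult_cross3_alpha_beta norm_g dx_g dy_g g_inner cross4_g[OF _ PQ]
      nu_def scaleR_add_right power2_eq_square field_simps)

lemma gx_gx: "z \<in> S \<Longrightarrow> gx z \<bullet> gx z = 4 * (s z)\<^sup>2"
  by (simp add: g_inner PQ)

lemma gy_gy: "z \<in> S \<Longrightarrow> gy z \<bullet> gy z = 4 * (c z)\<^sup>2"
  using c_pos[of z] by (simp add: g_inner PQ c_sq[symmetric])
    (simp add: c_sq)

lemma nu_inner:
  assumes z: "z \<in> S"
  shows "nu z \<bullet> nu z = 1" "nu z \<bullet> g z = 0" "nu z \<bullet> gx z = 0" "nu z \<bullet> gy z = 0"
proof -
  have nz: "s z \<noteq> 0" "c z \<noteq> 0" using s_pos[OF z] by auto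
  have gg: "f z \<bullet> gy z = - 2 * eps" "f z \<bullet> gx z = 0" "gy z \<bullet> gx z = 0" "gy z \<bullet> g z = 0"
    using g_inner[OF z] by (simp_all add: inner_commute)
  have cs: "c z * c z = s z * s z + 1" using c_sq[of z] by (simp add: power2_eq_square)
  note i = nu_def inner_add_left inner_add_right g_inner(3-)[OF z] gg gy_gy[OF z] frame_V[OF z] norm_f[OF z]
  show "nu z \<bullet> g z = 0" "nu z \<bullet> gx z = 0" by (simp_all add: i)
  show gy: "nu z \<bullet> gy z = 0" using nz by (simp add: i power2_eq_square field_simps)
  \<comment> \<open>Only one factor is expanded: \<open>nu\<close> is orthogonal to
    \<open>gy\<close>, which leaves its product with \<open>f\<close>.\<close>
  have "nu z \<bullet> nu z = (eps / (2 * s z * c z)) * (nu z \<bullet> gy z) + (c z / s z) * (nu z \<bullet> f z)"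
    by (subst (2) nu_def) (simp add: inner_add_right)
  also have "nu z \<bullet> f z = s z / c z"
    using nz by (simp add: i field_simps eps cs)
  finally show "nu z \<bullet> nu z = 1" using nz by (simp add: gy)
qed

text \<open>The first nine values arise as they did for \<open>f\<close>, because \<open>gx\<close>
  and \<open>gy\<close> have the same lengths as \<open>fx\<close> and \<open>fy\<close>. The normal
  ones follow since \<open>nu\<close> combines \<open>gy\<close> and \<open>f\<close>.\<close>

lemma g_second_inner:
  assumes z: "z \<in> S"
  shows "dx gx z \<bullet> g z = - 4 * (s z)\<^sup>2" "dy gx z \<bullet> g z = 0" "dy gy z \<bullet> g z = - 4 * (c z)\<^sup>2"
    "dx gx z \<bullet> gx z = 4 * s z * c z * px z" "dy gx z \<bullet> gx z = 4 * s z * c z * py z"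
    "dy gx z \<bullet> gy z = 4 * s z * c z * px z" "dy gy z \<bullet> gy z = 4 * s z * c z * py z"
    "dx gx z \<bullet> gy z = - 4 * s z * c z * py z" "dy gy z \<bullet> gx z = - 4 * s z * c z * px z"
    "dx gx z \<bullet> nu z = h11 z - 4 * eps * py z" "dy gx z \<bullet> nu z = h12 z + 4 * eps * px z"
    "dy gy z \<bullet> nu z = - (h11 z - 4 * eps * py z)"
proof -
  note D = has_partials_g[OF z] has_partials_gx[OF z] has_partials_gy[OF z, unfolded gyx[OF z]]
  have nz: "s z \<noteq> 0" "c z \<noteq> 0" using s_pos[OF z] by auto
  show "dx gx z \<bullet> g z = - 4 * (s z)\<^sup>2" "dy gx z \<bullet> g z = 0"
    using has_partials_inner_const[OF S z g_inner(4) D(1,2)] gx_gx[OF z] g_inner(3)[OF z]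
    by (simp_all add: inner_commute)
  show "dy gy z \<bullet> g z = - 4 * (c z)\<^sup>2"
    using has_partials_inner_const[OF S z g_inner(5) D(1,3)] gy_gy[OF z]
    by (simp add: inner_commute)
  have s2: "has_partials (\<lambda>w. 4 * (s w * s w)) (4 * (c z * px z * s z + s z * (c z * px z)))
      (4 * (c z * py z * s z + s z * (c z * py z))) z"
    by (intro has_partials_cmult has_partials_mult has_partials_s z)
  have "has_partials (\<lambda>w. gx w \<bullet> gx w) (4 * (c z * px z * s z + s z * (c z * px z)))
      (4 * (c z * py z * s z + s z * (c z * py z))) z"
    by (rule has_partials_cong[OF s2 S z]) (simp add: gx_gx power2_eq_square)
  from has_partials_unique[OF has_partials_inner[OF D(2,2)] this]
  show 1: "dx gx z \<bullet> gx z = 4 * s z * c z * px z" "dy gx z \<bullet> gx z = 4 * s z * c z * py z"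
    by (simp_all add: inner_commute)
  have c2: "has_partials (\<lambda>w. 4 * (c w * c w)) (4 * (s z * px z * c z + c z * (s z * px z)))
      (4 * (s z * py z * c z + c z * (s z * py z))) z"
    by (intro has_partials_cmult has_partials_mult has_partials_c z)
  have "has_partials (\<lambda>w. gy w \<bullet> gy w) (4 * (s z * px z * c z + c z * (s z * px z)))
      (4 * (s z * py z * c z + c z * (s z * py z))) z"
    by (rule has_partials_cong[OF c2 S z]) (simp add: gy_gy power2_eq_square)
  from has_partials_unique[OF has_partials_inner[OF D(3,3)] this]
  show 2: "dy gx z \<bullet> gy z = 4 * s z * c z * px z" "dy gy z \<bullet> gy z = 4 * s z * c z * py z"
    by (simp_all add: inner_commute)
  show 3: "dx gx z \<bullet> gy z = - 4 * s z * c z * py z" "dy gy z \<bullet> gx z = - 4 * s z * c z * px z"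
    using has_partials_inner_const[OF S z g_inner(3) D(2,3)] 1 2 by (simp_all add: inner_commute)
  \<comment> \<open>The products of \<open>gx\<close> and \<open>gy\<close> with \<open>f\<close>
    are constant, so the second derivative can be traded for a first derivative of
    \<open>f\<close>.\<close>
  have 4: "dx gx z \<bullet> f z = - 2 * s z * P z / c z" "dy gx z \<bullet> f z = 2 * s z * Q z / c z" "dy gy z \<bullet> f z = 2 * s z * P z / c z"
    using has_partials_inner_const[OF S z g_inner(6) D(2) has_partials_f[OF z]]
      has_partials_inner_const[OF S z g_inner(7) D(3) has_partials_f[OF z]] g_inner(8-)[OF z]
    by simp_all
  show "dx gx z \<bullet> nu z = h11 z - 4 * eps * py z" "dy gx z \<bullet> nu z = h12 z + 4 * eps * px z"
    "dy gy z \<bullet> nu z = - (h11 z - 4 * eps * py z)"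
    unfolding nu_def inner_add_right inner_scaleR_right 2 3 4 using nz by (simp_all add: P_def Q_def)
qed

lemma mu_g: "z \<in> S \<Longrightarrow> mu g z = Complex ((h11 z - 4 * eps * py z) / 2) (- (h12 z
  + 4 * eps * px z) / 2)"
proof -
  assume z: "z \<in> S"
  have D: "has_partials (dx g) (dx gx z) (dy gx z) z" "has_partials (dy g) (dx gy z) (dy gy z) z"
    by (rule has_partials_cong[OF has_partials_gx[OF z] S z] has_partials_cong[OF has_partials_gy[OF z] S z];
        simp add: dx_g dy_g)+
  have "del (del (\<lambda>w. cvec (g w))) z =
      (1/4) *s (cvec (dx (dx g) z - dy (dy g) z) - \<i> *s cvec (dx (dy g) z + dy (dx g) z))"
    by (rule del_del_cvec[OF S z])
      (use D has_partials_g has_partials_differentiable in blast)+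
  then have "mu g z = (1/4) * (of_real (dx gx z \<bullet> nu z - dy gy z \<bullet> nu z) - \<i> * of_real (dx gy z \<bullet> nu z + dy gx z \<bullet> nu z))"
    by (simp only: mu_def nrm_g[OF z] cdot_linear cdot_cvec inner_diff_left inner_add_left
       has_partials_dx[OF D(1)] has_partials_dy[OF D(1)] has_partials_dx[OF D(2)] has_partials_dy[OF D(2)])
  then show ?thesis
    by (simp add: z gyx g_second_inner complex_eq_iff)
qed

end

section \<open>Constancy of \<open>phi\<close> and of \<open>mu\<close>\<close>

context adapted_harmonic
begin

lemma phi_constant_iff:
  assumes "connected S"
  shows "p constant_on S \<longleftrightarrow> (\<forall>z\<in>S. px z = 0 \<and> py z = 0)"
proof
  assume "p constant_on S"
  then obtain k where k: "\<And>z. z \<in> S \<Longrightarrow> p z = k" by (auto simp: constant_on_def)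
  show "\<forall>z\<in>S. px z = 0 \<and> py z = 0"
  proof
    fix z assume z: "z \<in> S"
    have "has_partials p 0 0 z"
      by (rule has_partials_cong[OF has_partials_const S z]) (simp add: k)
    then show "px z = 0 \<and> py z = 0" by (simp add: has_partials_dx has_partials_dy)
  qed
next
  assume "\<forall>z\<in>S. px z = 0 \<and> py z = 0"
  then have "has_partials p 0 0 z" if "z \<in> S" for z using has_partials_p[OF that] that by simp
  from has_partials_zero_constant[OF S assms this] show "p constant_on S"
    unfolding constant_on_def by metis
qed

text \<open>For constant nonzero \<open>mu\<close> the Codazzi equations are a linear system for
  \<open>px\<close> and \<open>py\<close> with nonzero determinant. For constant \<open>phi\<close>
  they become the Cauchy-Riemann equations of \<open>mu\<close>, and the Gauss equation fixes its
  nonzero modulus, so \<open>mu\<close> is constant.\<close>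

lemma mu_constant_iff:
  assumes conn: "connected S"
  shows "(\<exists>k. k \<noteq> 0 \<and> (\<forall>z\<in>S. mu f z = k)) \<longleftrightarrow> (\<forall>z\<in>S. px z = 0 \<and> py z = 0)"
proof
  assume "\<exists>k. k \<noteq> 0 \<and> (\<forall>z\<in>S. mu f z = k)"
  then obtain k where k: "k \<noteq> 0" "\<And>z. z \<in> S \<Longrightarrow> mu f z = k" by blast
  have h: "h11 z = 2 * Re k" "h12 z = - 2 * Im k" if "z \<in> S" for z
    using k(2)[OF that] mu_eq[OF that] by auto
  show "\<forall>z\<in>S. px z = 0 \<and> py z = 0"
  proof
    fix z assume z: "z \<in> S"
    have "has_partials h11 0 0 z" "has_partials h12 0 0 z"
      by (rule has_partials_cong[OF has_partials_const S z]; simp add: h)+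
    then have d: "dx h11 z = 0" "dy h11 z = 0" "dx h12 z = 0" "dy h12 z = 0"
      by (simp_all add: has_partials_dx has_partials_dy)
    have nz: "s z * c z \<noteq> 0" using s_pos[OF z] by simp
    have e: "h11 z * px z + h12 z * py z = 0" "h12 z * px z - h11 z * py z = 0"
      using codazzi[OF z] nz by (simp_all add: d)
    have "(h11 z)\<^sup>2 + (h12 z)\<^sup>2 \<noteq> 0"
    proof -
      have "h11 z \<noteq> 0 \<or> h12 z \<noteq> 0" using k(1) by (auto simp: h[OF z] complex_eq_iff)
      then show ?thesis by (simp add: sum_power2_eq_zero_iff)
    qed
    moreover have "((h11 z)\<^sup>2 + (h12 z)\<^sup>2) * px z = 0" "((h11 z)\<^sup>2 + (h12 z)\<^sup>2) * py z = 0"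
      using e by algebra+
    ultimately show "px z = 0 \<and> py z = 0" by auto
  qed
next
  assume 0: "\<forall>z\<in>S. px z = 0 \<and> py z = 0"
  then obtain k where k: "\<And>z. z \<in> S \<Longrightarrow> p z = k"
    using phi_constant_iff[OF conn] by (auto simp: constant_on_def)
  have norm: "(h11 z)\<^sup>2 + (h12 z)\<^sup>2 = 16 * (sinh k)\<^sup>2 * (cosh k)\<^sup>2" if "z \<in> S" for z
    using gauss_constant_phi[OF _ _ that] 0 by (simp add: k that)
  have d: "has_partials h11 0 0 z" "has_partials h12 0 0 z" if z: "z \<in> S" for z
  proof -
    have n0: "(h11 z)\<^sup>2 + (h12 z)\<^sup>2 \<noteq> 0"
      using norm[OF z] s_pos[OF z] by (simp add: k z)
    note h = has_partials_h11[OF z] has_partials_h12[OF z]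
    have "has_partials (\<lambda>w. h11 w * h11 w + h12 w * h12 w) 0 0 z"
      by (rule has_partials_cong[OF has_partials_const[of "16 * (sinh k)\<^sup>2 * (cosh k)\<^sup>2"] S z])
        (simp add: norm[symmetric] flip: power2_eq_square)
    from has_partials_unique[OF has_partials_add[OF has_partials_mult[OF h(1,1)] has_partials_mult[OF h(2,2)]] this]
    have "h11 z * dx h11 z + h12 z * dx h12 z = 0" "h11 z * dy h11 z + h12 z * dy h12 z = 0"
      by (simp_all add: algebra_simps)
    moreover have "dx h11 z = - dy h12 z" "dy h11 z = dx h12 z" using codazzi[OF z] 0 z by simp_all
    ultimately have "((h11 z)\<^sup>2 + (h12 z)\<^sup>2) * dx h11 z = 0" "((h11 z)\<^sup>2
      + (h12 z)\<^sup>2) * dy h11 z = 0"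
      by algebra+
    with n0 have "dx h11 z = 0" "dy h11 z = 0" by auto
    with h codazzi[OF z] 0 z show "has_partials h11 0 0 z" "has_partials h12 0 0 z" by simp_all
  qed
  show "\<exists>k. k \<noteq> 0 \<and> (\<forall>z\<in>S. mu f z = k)"
  proof (cases "S = {}")
    \<comment> \<open>On an empty domain any nonzero constant serves.\<close>
    case True then show ?thesis by (intro exI[of _ 1]) simp
  next
    case False
    then obtain z where z: "z \<in> S" by blast
    have "mu f z \<noteq> 0" using mu_eq[OF z] norm[OF z] s_pos[OF z] by (auto simp: k z complex_eq_iff)
    moreover have "mu f w = mu f z" if w: "w \<in> S" for w
      using has_partials_zero_constant[OF S conn d(1) w z] has_partials_zero_constant[OF S conn d(2) w z]
      by (simp add: mu_eq w z)
    ultimately show ?thesis by blast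
  qed
qed

end

section \<open>Congruence when \<open>phi\<close> agrees with that of the transform\<close>

context adapted_transform_phi
begin

lemma mu_g_eq_iff: "z \<in> S \<Longrightarrow> mu f z = mu g z \<longleftrightarrow> px z = 0 \<and> py z = 0"
  using eps by (auto simp: mu_eq mu_g)

text \<open>An orientation preserving congruence makes \<open>\<mu>\<close> invariant
  and hence \<open>\<phi>\<close> critical.  An
  orientation reversing one changes the sign of \<open>\<mu>\<close>, which forces \<open>P = Q = 0\<close>, that is, a
  vanishing \<open>\<phi>\<close> of the transform.\<close>

lemma congruent_imp_critical:
  assumes R: "orthogonal_transformation R" and gR: "\<And>w. w \<in> S \<Longrightarrow> g w = R (f w)"
    and z: "z \<in> S"
  shows "px z = 0 \<and> py z = 0"
proof -
  have L: "bounded_linear R" using R by (simp add: orthogonal_transformation_def linear_conv_bounded_linear)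
  have R_inner: "R v \<bullet> R w = v \<bullet> w" for v w using R by (simp add: orthogonal_transformation_def)
  have g1: "gx w = R (fx w)" "gy w = R (fy w)" if w: "w \<in> S" for w
    using has_partials_unique[OF has_partials_g[OF w]
      has_partials_cong[OF has_partials_linear[OF L has_partials_f[OF w]] S w]] gR by auto
  have g2: "dx gx z = R (fxx z)" "dy gx z = R (fxy z)"
    using has_partials_unique[OF has_partials_gx[OF z]
      has_partials_cong[OF has_partials_linear[OF L has_partials_fx[OF z]] S z]] g1(1) by auto
  have nz: "s z \<noteq> 0" "c z \<noteq> 0" using s_pos[OF z] by auto
  \<comment> \<open>Since \<open>R\<close> carries \<open>f\<close>, \<open>fx\<close>,
    \<open>fy\<close> to \<open>g\<close>, \<open>gx\<close>, \<open>gy\<close>, it carries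
    \<open>nv\<close> to plus or minus \<open>nu\<close>; \<open>\<kappa>\<close> is this
    sign.\<close>
  define \<kappa> where "\<kappa> = nu z \<bullet> R (nv z)"
  note lin = linear_cmul[OF bounded_linear.linear[OF L]]
  have o: "orthonormal4 (R (f z)) (R (e1 z)) (R (e2 z)) (R (nv z))"
    using frame[OF z] by (simp add: orthonormal4_def R_inner)
  have "nu z \<bullet> R (f z) = 0" "nu z \<bullet> R (e1 z) = 0" "nu z \<bullet> R (e2 z) = 0"
    using nu_inner(2)[OF z] nu_inner(3,4)[OF z] nz by (simp_all add: gR[OF z] g1[OF z] fx_e1[OF z] fy_e2 lin)
  then have nu: "nu z = \<kappa> *\<^sub>R R (nv z)"
    using orthonormal4_expand[OF o, of "nu z"] by (simp add: \<kappa>_def)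
  have "\<kappa> * \<kappa> = 1" using nu_inner(1)[OF z] frame_inner(4)[OF z] by (simp add: nu R_inner)
  then consider "\<kappa> = 1" | "\<kappa> = -1" by (metis square_eq_1_iff)
  moreover have h: "h11 z - 4 * eps * py z = \<kappa> * h11 z" "h12 z + 4 * eps * px z = \<kappa> * h12 z"
    using g_second_inner(10,11)[OF z] by (simp_all add: nu g2 R_inner h11_def h12_def)
  ultimately show ?thesis
  proof cases
    case 1 then show ?thesis using h eps by auto
  next
    case 2
    then have "P z = 0" "Q z = 0" using h by (simp_all add: P_def Q_def)
    then have False using PQ[OF z] nz by simp
    then show ?thesis ..
  qed
qed

text \<open>When \<open>\<phi>\<close> is constant, the frames of \<open>f\<close>
  and of its transform satisfy the same structure
  equations, so the isometry carrying one frame to the other does not depend on the point.\<close>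

lemma critical_imp_congruent:
  assumes 0: "\<And>w. w \<in> S \<Longrightarrow> px w = 0 \<and> py w = 0" and conn: "connected S"
  shows "congruent_on f g S"
proof (cases "S = {}")
  case True
  then show ?thesis unfolding congruent_on_def
    by (intro exI[of _ "\<lambda>v. v"]) (simp add: orthogonal_transformation_def linear_iff)
next
  case False
  then obtain z0 where z0: "z0 \<in> S" by blast
  obtain k where k: "\<And>z. z \<in> S \<Longrightarrow> p z = k"
    using phi_constant_iff[OF conn] 0 by (auto simp: constant_on_def)
  define A C where "A = 2 * sinh k" and "C = 2 * cosh k"
  have sA: "2 * s z = A" "2 * c z = C" if "z \<in> S" for z using k[OF that] by (simp_all add: A_def C_def)
  have sA': "s z = A / 2" "c z = C / 2" if "z \<in> S" for z using k[OF that] by (simp_all add: A_def C_def)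
  have AC: "A \<noteq> 0" "C \<noteq> 0" using s_pos[OF z0] sA'[OF z0] by auto
  \<comment> \<open>The linear map taking the frame of \<open>f\<close> at \<open>z\<close> to the
    frame of \<open>g\<close> at \<open>z\<close>, applied to \<open>v\<close>; \<open>A\<close> and
    \<open>C\<close> are the constant lengths of the partials.\<close>
  define M where "M = (\<lambda>v z. (v \<bullet> f z) *\<^sub>R g z
    + (v \<bullet> fx z / A\<^sup>2) *\<^sub>R gx z + (v \<bullet> fy z / C\<^sup>2) *\<^sub>R gy z
    + (v \<bullet> nv z) *\<^sub>R nu z)"
  have o: "orthonormal4 (g z) ((1 / A) *\<^sub>R gx z) ((1 / C) *\<^sub>R gy z) (nu z)" if z: "z \<in> S" for z
    using AC g_inner(3-5)[OF z] nu_inner[OF z] gx_gx[OF z] gy_gy[OF z] frame_V(10)[OF z]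
    by (simp add: orthonormal4_def sA'[OF z] inner_commute power2_eq_square)
  have expand: "v = (v \<bullet> g z) *\<^sub>R g z + (v \<bullet> gx z / A\<^sup>2) *\<^sub>R gx z
    + (v \<bullet> gy z / C\<^sup>2) *\<^sub>R gy z + (v \<bullet> nu z) *\<^sub>R nu z"
    if "z \<in> S" for v z
    using orthonormal4_expand[OF o[OF that], of v] by (simp add: power2_eq_square)
  have M0: "has_partials (M v) 0 0 z" if z: "z \<in> S" for v z
  proof -
    have "nu differentiable (at z)"
    proof -
      have "has_partials (\<lambda>w. (2 * eps / (A * C)) *\<^sub>R gy w + (C / A) *\<^sub>R f w)
          ((2 * eps / (A * C)) *\<^sub>R dx gy z + (C / A) *\<^sub>R fx z) ((2 * eps / (A * C)) *\<^sub>R dy gy z + (C / A) *\<^sub>R fy z) z"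
        by (intro has_partials_add has_partials_linear[OF bounded_linear_scaleR_right] has_partials_gy has_partials_f z)
      from has_partials_cong[OF this S z, of nu] show ?thesis
        using has_partials_differentiable by (simp add: nu_def sA')
    qed
    from differentiable_has_partials[OF this] obtain a b where n: "has_partials nu a b z" by blast
    note gs = g_second_inner[OF z] and gP = has_partials_g[OF z] has_partials_gx[OF z] has_partials_gy[OF z]
    have 1: "a \<bullet> nu z = 0" "b \<bullet> nu z = 0"
      using has_partials_inner_const[OF S z nu_inner(1) n n] by (simp_all add: inner_commute)
    have 2: "a \<bullet> g z = 0" "b \<bullet> g z = 0"
      using has_partials_inner_const[OF S z nu_inner(2) n gP(1)] nu_inner[OF z] by simp_all
    \<comment> \<open>As \<open>phi\<close> is critical, the normal coefficients of the second
      derivatives of \<open>g\<close> are \<open>h11\<close>, \<open>h12\<close> again, and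
      \<open>nu\<close> obeys the same Weingarten equations as \<open>nv\<close>.\<close>
    have 3: "a \<bullet> gx z = - h11 z" "b \<bullet> gx z = - h12 z"
      using has_partials_inner_const[OF S z nu_inner(3) n gP(2)] gs(10,11) 0[OF z] by (simp_all add: inner_commute)
    have 4: "a \<bullet> gy z = - h12 z" "b \<bullet> gy z = h11 z"
      using has_partials_inner_const[OF S z nu_inner(4) n gP(3)] gs(11,12) 0[OF z] gyx[OF z]
      by (simp_all add: inner_commute)
    have ab: "a = - (h11 z / A\<^sup>2) *\<^sub>R gx z - (h12 z / C\<^sup>2) *\<^sub>R gy z" "b = - (h12 z / A\<^sup>2) *\<^sub>R gx z + (h11 z / C\<^sup>2) *\<^sub>R gy z"
      using expand[OF z, of a] expand[OF z, of b] by (simp_all add: 1 2 3 4)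
    have gg: "dx gx z = (- A\<^sup>2) *\<^sub>R g z + h11 z *\<^sub>R nu z" "dy gx z = h12 z *\<^sub>R nu z"
      "dx gy z = h12 z *\<^sub>R nu z" "dy gy z = (- C\<^sup>2) *\<^sub>R g z - h11 z *\<^sub>R nu z"
      using expand[OF z, of "dx gx z"] expand[OF z, of "dy gx z"] expand[OF z, of "dy gy z"]
      by (simp_all add: gs 0[OF z] gyx[OF z] sA'[OF z] power_divide)
    have ff: "fxx z = (- A\<^sup>2) *\<^sub>R f z + h11 z *\<^sub>R nv z" "fxy z = h12 z *\<^sub>R nv z" "fyy z = (- C\<^sup>2) *\<^sub>R f z - h11 z *\<^sub>R nv z"
      using second_derivatives[OF z] 0[OF z] by (simp_all add: sA'[OF z] power_divide)
    have nn: "- (h11 z / (2 * s z)) *\<^sub>R e1 z - (h12 z / (2 * c z)) *\<^sub>R e2 z = - (h11 z / A\<^sup>2) *\<^sub>R fx z - (h12 z / C\<^sup>2) *\<^sub>R fy z"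
      "- (h12 z / (2 * s z)) *\<^sub>R e1 z + (h11 z / (2 * c z)) *\<^sub>R e2 z = - (h12 z / A\<^sup>2) *\<^sub>R fx z + (h11 z / C\<^sup>2) *\<^sub>R fy z"
      using AC by (simp_all add: e1_def e2_def sA[OF z] power2_eq_square)
    note fn = has_partials_nv[OF z, unfolded nn]
    have lin: "has_partials (\<lambda>w. v \<bullet> F w) (v \<bullet> x) (v \<bullet> y) z" if "has_partials F x y z" for F :: "complex \<Rightarrow> real^4" and x y
      by (rule has_partials_linear[OF bounded_linear_inner_right that])
    have lin': "has_partials (\<lambda>w. v \<bullet> F w / r) (v \<bullet> x / r) (v \<bullet> y / r) z" if "has_partials F x y z" for F :: "complex \<Rightarrow> real^4" and x y r
      using has_partials_cmult[OF lin[OF that], of "1 / r"] by simp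
    note D = has_partials_add[OF has_partials_add[OF has_partials_add[OF
        has_partials_scaleR[OF lin[OF has_partials_f[OF z]] gP(1)]
        has_partials_scaleR[OF lin'[OF has_partials_fx[OF z], where r = "A\<^sup>2"] gP(2)]]
        has_partials_scaleR[OF lin'[OF has_partials_fy[OF z], where r = "C\<^sup>2"] gP(3)]]
        has_partials_scaleR[OF lin[OF fn] n]]
    \<comment> \<open>Both frames satisfy the same linear system, and it is skew relative to the
      squared lengths 1, \<open>A\<^sup>2\<close>, \<open>C\<^sup>2\<close>, 1; hence the terms of
      the product rule cancel in pairs.\<close>
    have "has_partials (\<lambda>w. (v \<bullet> f w) *\<^sub>R g w
      + (v \<bullet> fx w / A\<^sup>2) *\<^sub>R gx w + (v \<bullet> fy w / C\<^sup>2) *\<^sub>R gy w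
        + (v \<bullet> nv w) *\<^sub>R nu w) 0 0 z"
      by (rule back_subst[of "\<lambda>x. has_partials _ x _ z", OF back_subst[of "\<lambda>y. has_partials _ _ y z", OF D]])
        (use AC in \<open>simp_all add: ab gg ff inner_add_right inner_diff_right algebra_simps diff_divide_distrib add_divide_distrib\<close>)
    then show ?thesis by (simp add: M_def)
  qed
  \<comment> \<open>By \<open>M0\<close> the value of \<open>M v\<close> is the same at every point,
    so the map at the base point serves on all of \<open>S\<close>.\<close>
  define R where "R v = M v z0" for v
  have fi: "f z \<bullet> f z = 1" "f z \<bullet> fx z = 0" "f z \<bullet> fy z = 0" "f z \<bullet> nv z = 0" if "z \<in> S" for z
    using f_perp[OF that] frame_inner[OF that] by simp_all
  have "g z = R (f z)" if z: "z \<in> S" for z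
  proof -
    have "R (f z) = M (f z) z"
      unfolding R_def by (rule has_partials_zero_constant[OF S conn M0 z0 z])
    then show ?thesis by (simp add: M_def fi[OF z])
  qed
  moreover have "orthogonal_transformation R"
  proof -
    have "linear R"
      by (rule linearI) (simp_all add: R_def M_def inner_add_left add_divide_distrib algebra_simps)
    moreover have "R v \<bullet> R v = v \<bullet> v" for v
    proof -
      have n: "orthonormal4 (f z0) (e1 z0) (e2 z0) (nv z0)" by (rule frame[OF z0])
      \<comment> \<open>Parseval: \<open>v\<close> and \<open>R v\<close> have the same coefficients
        in their respective orthonormal frames.\<close>
      have sq: "x \<bullet> x = (v \<bullet> f z0)\<^sup>2 + (v \<bullet> e1 z0)\<^sup>2
      + (v \<bullet> e2 z0)\<^sup>2 + (v \<bullet> nv z0)\<^sup>2"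
        if "x = (v \<bullet> f z0) *\<^sub>R a + (v \<bullet> e1 z0) *\<^sub>R b
        + (v \<bullet> e2 z0) *\<^sub>R c + (v \<bullet> nv z0) *\<^sub>R d"
          "orthonormal4 a b c d" for x a b c d
        using that by (simp add: orthonormal4_def inner_add_left inner_add_right inner_commute power2_eq_square)
      have "R v = (v \<bullet> f z0) *\<^sub>R g z0 + (v \<bullet> e1 z0) *\<^sub>R (1 / A) *\<^sub>R gx z0
      + (v \<bullet> e2 z0) *\<^sub>R (1 / C) *\<^sub>R gy z0 + (v \<bullet> nv z0) *\<^sub>R nu z0"
        by (simp add: R_def M_def e1_def e2_def sA[OF z0] power2_eq_square)
      from sq[OF this o[OF z0]] sq[OF orthonormal4_expand[OF n] n] show ?thesis by simp
    qed
    ultimately show ?thesis by (simp add: orthogonal_transformation norm_eq_sqrt_inner)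
  qed
  ultimately show ?thesis unfolding congruent_on_def by blast
qed

end

section \<open>Congruence\<close>

text \<open>Partial derivatives commute with \<open>L\<close>. The function \<open>G\<close> is
  generalised in the induction because the partials of \<open>G\<close> agree with the images of
  those of \<open>F\<close> on \<open>S\<close> only.\<close>

lemma Ck_on_linear:
  assumes L: "bounded_linear L" and S: "open S"
  shows "Ck_on k F S \<Longrightarrow> (\<And>z. z \<in> S \<Longrightarrow> G z = L (F z)) \<Longrightarrow> Ck_on k G S"
proof (induction k arbitrary: F G)
  case 0
  then have "continuous_on S (\<lambda>z. L (F z))"
    using bounded_linear.continuous_on[OF L] by auto
  then show ?case using 0(2) by (simp cong: continuous_on_cong)
next
  case (Suc k)
  have P: "has_partials G (L (dx F z)) (L (dy F z)) z" if z: "z \<in> S" for z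
    by (rule has_partials_cong[OF has_partials_linear[OF L differentiable_has_partials] S z])
      (use Suc.prems z in auto)
  show ?case
    using Suc.prems(1) Suc.IH[of "dx F" "dx G"] Suc.IH[of "dy F" "dy G"]
      P[THEN has_partials_dx] P[THEN has_partials_dy] P[THEN has_partials_differentiable] by simp
qed

lemma congruent_on_refl: "congruent_on f f S"
  unfolding congruent_on_def
  by (rule exI[of _ "\<lambda>v. v"]) (simp add: orthogonal_transformation_def linear_iff)

lemma congruent_on_sym: "congruent_on f g S \<Longrightarrow> congruent_on g f S"
proof -
  assume "congruent_on f g S"
  then obtain R where R: "orthogonal_transformation R" "\<And>z. z \<in> S \<Longrightarrow> g z = R (f z)"
    unfolding congruent_on_def by blast
  have "f z = inv R (g z)" if "z \<in> S" for z
    using R(2)[OF that] orthogonal_transformation_inj[OF R(1)] by (simp add: inv_f_f)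
  then show ?thesis unfolding congruent_on_def using orthogonal_transformation_inv[OF R(1)] by blast
qed

lemma congruent_on_trans: "congruent_on f g S \<Longrightarrow> congruent_on g h S \<Longrightarrow> congruent_on f h S"
proof -
  assume "congruent_on f g S" "congruent_on g h S"
  then obtain R T where "orthogonal_transformation R" "\<And>z. z \<in> S \<Longrightarrow> g z = R (f z)"
    "orthogonal_transformation T" "\<And>z. z \<in> S \<Longrightarrow> h z = T (g z)"
    unfolding congruent_on_def by blast
  then show ?thesis unfolding congruent_on_def
    by (intro exI[of _ "T \<circ> R"]) (simp add: orthogonal_transformation_compose)
qed

context adapted_harmonic
begin

text \<open>In real form the conditions are linear relations and inner products of derivatives,
  preserved by every orthogonal map of either orientation; \<open>phi\<close> depends only on the
  length of the first partial.\<close>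

lemma congruent_adapted_harmonic:
  assumes "congruent_on f h S"
  shows "adapted_harmonic S h" and "\<And>z. z \<in> S \<Longrightarrow> phi h z = p z"
proof -
  obtain R where R: "orthogonal_transformation R" and hR: "\<And>w. w \<in> S \<Longrightarrow> h w = R (f w)"
    using assms unfolding congruent_on_def by blast
  have L: "bounded_linear R" using R by (simp add: orthogonal_transformation_def linear_conv_bounded_linear)
  note lin = bounded_linear.linear[OF L]
  have R_inner: "R v \<bullet> R w = v \<bullet> w" for v w using R by (simp add: orthogonal_transformation_def)
  have R_norm: "norm (R v) = norm v" for v by (simp add: norm_eq_sqrt_inner R_inner)
  have 1: "has_partials h (R (fx w)) (R (fy w)) w" if w: "w \<in> S" for w
    by (rule has_partials_cong[OF has_partials_linear[OF L has_partials_f[OF w]] S w]) (simp add: hR)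
  note d1 = 1[THEN has_partials_dx] 1[THEN has_partials_dy]
  have 2: "has_partials (dx h) (R (fxx w)) (R (fxy w)) w" "has_partials (dy h) (R (fxy w)) (R (fyy w)) w"
    if w: "w \<in> S" for w
    by (rule has_partials_cong[OF has_partials_linear[OF L has_partials_fx[OF w]] S w]
        has_partials_cong[OF has_partials_linear[OF L has_partials_fy[OF w]] S w]; simp add: d1)+
  note d2 = 2(1)[THEN has_partials_dx] 2(1)[THEN has_partials_dy] 2(2)[THEN has_partials_dx] 2(2)[THEN has_partials_dy]
  have smooth': "smooth_map_on h S"
    unfolding smooth_map_on_def
    by (rule allI, rule Ck_on_linear[OF L S, of _ f]) (use smooth hR in \<open>auto simp: smooth_map_on_def\<close>)
  have unit: "norm (h z) = 1" "h z \<bullet> dx h z = 0" "h z \<bullet> dy h z = 0" if "z \<in> S" for z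
    by (simp_all add: hR that R_norm norm_f' d1 R_inner f_perp)
  have norms: "norm (dx h z) = norm (fx z)" "norm (dy h z) = norm (fy z)" if "z \<in> S" for z
    by (simp_all add: d1 that R_norm)
  show "adapted_harmonic S h"
  proof
    have "dx (dx h) z + dy (dy h) z = - (dx h z \<bullet> dx h z
      + dy h z \<bullet> dy h z) *\<^sub>R h z" if z: "z \<in> S" for z
    proof -
      have "R (fxx z + fyy z) = R (- (fx z \<bullet> fx z + fy z \<bullet> fy z) *\<^sub>R f z)"
      by (simp only: laplace[OF z])
      then show ?thesis
        unfolding d1[OF z] d2[OF z] hR[OF z] R_inner linear_add[OF lin] linear_cmul[OF lin] .
    qed
    then show "harmonic_map_on h S"
      using smooth' unit(1) by (simp add: harmonic_map_on_iff[OF S] d2 norm_eq_1)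
    show "adapted_on h S"
      by (simp add: adapted_on_iff[OF smooth'] d1 R_inner adapted')
    show "alpha h z \<noteq> 0" if "z \<in> S" for z
      using norm_alpha[of h z] unit[OF that] norms[OF that] fx_nz[OF that] by auto
  qed (rule S)
  then show "phi h z = p z" if "z \<in> S" for z
    using adapted_harmonic.phi_eq[of S h z] phi_eq[OF that] norms[OF that] that by simp
qed

end

section \<open>The equivalences with constant \<open>phi\<close>\<close>

context adapted_transform
begin

text \<open>For critical \<open>p\<close> one has \<open>P = - h11 / 2\<close> and
  \<open>Q = h12 / 2\<close>, so the Gauss equation is exactly the required relation.\<close>

lemma critical_imp_adapted_transform_phi:
  assumes "\<And>w. w \<in> S \<Longrightarrow> px w = 0 \<and> py w = 0"
  shows "adapted_transform_phi S f eps"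
proof unfold_locales
  fix z assume z: "z \<in> S"
  have "(P z)\<^sup>2 + (Q z)\<^sup>2 = ((h11 z)\<^sup>2 + (h12 z)\<^sup>2) / 4"
    using assms[OF z] by (simp add: P_def Q_def power_divide)
  also have "\<dots> = 4 * (s z)\<^sup>2 * (c z)\<^sup>2" using assms gauss_constant_phi[OF _ _ z] by simp
  finally show "(P z)\<^sup>2 + (Q z)\<^sup>2 = 4 * (s z)\<^sup>2 * (c z)\<^sup>2" .
qed

lemma phi_g_eq_imp_adapted_transform_phi:
  "(\<And>z. z \<in> S \<Longrightarrow> phi g z = p z) \<Longrightarrow> adapted_transform_phi S f eps"
  by unfold_locales (use phi_g_eq_iff in blast)

lemma congruent_iff:
  assumes conn: "connected S"
  shows "congruent_on f g S \<longleftrightarrow> p constant_on S"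
proof
  assume A: "congruent_on f g S"
  \<comment> \<open>Congruent maps share \<open>phi\<close>, which places the situation in the
    locale where the normal and \<open>mu\<close> of the transform are known.\<close>
  then interpret adapted_transform_phi S f eps
    by (intro phi_g_eq_imp_adapted_transform_phi congruent_adapted_harmonic(2))
  show "p constant_on S"
    using A congruent_imp_critical by (auto simp: phi_constant_iff[OF conn] congruent_on_def)
next
  assume "p constant_on S"
  then have 0: "px z = 0 \<and> py z = 0" if "z \<in> S" for z
    using phi_constant_iff[OF conn] that by blast
  then interpret adapted_transform_phi S f eps by (rule critical_imp_adapted_transform_phi)
  show "congruent_on f g S" by (rule critical_imp_congruent[OF 0 conn])
qed

lemma invariants_iff:
  assumes conn: "connected S"
  shows "(\<forall>z\<in>S. p z = phi g z \<and> mu f z = mu g z) \<longleftrightarrow> p constant_on S"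
proof
  assume B: "\<forall>z\<in>S. p z = phi g z \<and> mu f z = mu g z"
  then interpret adapted_transform_phi S f eps
    by (intro phi_g_eq_imp_adapted_transform_phi) simp
  show "p constant_on S"
    using B mu_g_eq_iff by (simp add: phi_constant_iff[OF conn])
next
  assume "p constant_on S"
  then have 0: "px z = 0 \<and> py z = 0" if "z \<in> S" for z
    using phi_constant_iff[OF conn] that by blast
  then interpret adapted_transform_phi S f eps by (rule critical_imp_adapted_transform_phi)
  show "\<forall>z\<in>S. p z = phi g z \<and> mu f z = mu g z"
    using 0 mu_g_eq_iff phi_g_eq by simp
qed

end

text \<open>An iterate congruent to \<open>f\<close> is itself harmonic and adapted with the same
  constant \<open>phi\<close>, so the equivalence applies to it and gives the next
  congruence.\<close>

lemma congruent_on_iterated_transform: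
  assumes "adapted_harmonic S f" "connected S" "phi f constant_on S" and eps: "eps * eps = 1"
  shows "congruent_on f ((transform eps ^^ n) f) S"
proof (induction n)
  case 0
  then show ?case by (simp add: congruent_on_refl)
next
  case (Suc n)
  let ?h = "(transform eps ^^ n) f"
  interpret f: adapted_harmonic S f by fact
  note h = f.congruent_adapted_harmonic[OF Suc]
  interpret h: adapted_transform S ?h eps
    by (rule adapted_transform.intro[OF h(1)]) (unfold_locales, rule eps)
  have "phi ?h constant_on S" using assms(3) h(2) by (simp add: constant_on_def)
  then have "congruent_on ?h (transform eps ?h) S" using h.congruent_iff[OF assms(2)] by simp
  with Suc show ?case by (simp add: congruent_on_trans)
qed

theorem theorem4p3:
  fixes S :: "complex set" and f :: "complex \<Rightarrow> real^4" and eps :: real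
  assumes "open S" and "connected S" and "S \<noteq> {}"
    and "eps \<in> {1, -1}"
    and "harmonic_map_on f S"
    and "nonconformal_on f S"
    and "adapted_on f S"
    and "\<forall>z\<in>S. alpha f z \<noteq> 0"
  shows
    "let fe = transform eps f;
         A = congruent_on f fe S;
         B = (\<forall>z\<in>S. phi f z = phi fe z \<and> mu f z = mu fe z);
         C = phi f constant_on S;
         D = (\<exists>c. c \<noteq> 0 \<and> (\<forall>z\<in>S. mu f z = c))
     in (A \<longleftrightarrow> B) \<and> (A \<longleftrightarrow> C) \<and> (A \<longleftrightarrow> D) \<and>
        (A \<or> B \<or> C \<or> D \<longrightarrow> (\<forall>p q. congruent_on (assoc_seq f p) (assoc_seq f q) S))"
proof -
  interpret adapted_transform S f eps
    using assms by unfold_locales auto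
  have A: "congruent_on f (transform eps f) S \<longleftrightarrow> phi f constant_on S"
    by (rule congruent_iff[OF assms(2)])
  have B: "(\<forall>z\<in>S. phi f z = phi (transform eps f) z \<and> mu f z = mu (transform eps f) z) \<longleftrightarrow> phi f constant_on S"
    by (rule invariants_iff[OF assms(2)])
  have D: "(\<exists>c. c \<noteq> 0 \<and> (\<forall>z\<in>S. mu f z = c)) \<longleftrightarrow> phi f constant_on S"
    using mu_constant_iff[OF assms(2)] phi_constant_iff[OF assms(2)] by simp
  \<comment> \<open>Constancy of \<open>phi\<close> does not involve the sign, so the iteration
    covers both directions of the sequence, with sign 1 and with sign -1.\<close>
  have "congruent_on f (assoc_seq f p) S" if "phi f constant_on S" for p
    using congruent_on_iterated_transform[OF adapted_harmonic_axioms assms(2) that] by (simp add: assoc_seq_def)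
  then have "\<forall>p q. congruent_on (assoc_seq f p) (assoc_seq f q) S" if "phi f constant_on S"
    using that congruent_on_sym congruent_on_trans by blast
  then show ?thesis unfolding Let_def A B D by blast
qed

end
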